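(* Let $K$ be a complete, algebraically closed nonarchimedean valued field and let $\varphi(z)=(az+b)/(cz+e)\in K(z)$ with $ae-bc\ne0$ (so $\deg\varphi=1$). Then $B_0(\varphi)=1$ and $$\mathrm{Lip}_{\mathrm{Berk}}(\varphi)=\mathrm{Lip}_{\mathbf P^1(K)}(\varphi)=\frac{1}{\mathrm{GIR}(\varphi)}=\frac{1}{\mathrm{GPR}(\varphi)}=\frac{1}{|\mathrm{Res}(\varphi)|}=\frac{\max(|a|,|b|,|c|,|e|)}{|ae-bc|}.$$
   Context: $K$ is a complete, algebraically closed field with a nontrivial nonarchimedean absolute value $|\cdot|$; $\mathcal O=\{|z|\le1\}$, $\mathcal O^\times$ its units. Fix $q>1$, $\log=\log_q$. $\mathbf P^1_{\mathrm{Berk}}$ is the Berkovich projective line over $K$ (a uniquely path-connected tree containing $\mathbf P^1(K)$); $\zeta_{a,r}$ is the point of the disc $D(a,r)=\{z:|z-a|\le r\}$, $\zeta_{a,0}=a$, $\zeta_G=\zeta_{0,1}$; $[x,y]$ the unique path. $\rho$ is the logarithmic path metric on $\mathbf H^1=\mathbf P^1_{\mathrm{Berk}}\setminus\mathbf P^1(K)$ (path $\{\zeta_{a,r}:R_1\le r\le R_2\}$ has length $\log(R_2/R_1)$); $\mathrm{diam}_G(x)=q^{-\rho(\zeta_G,x)}$ on $\mathbf H^1$, $0$ on $\mathbf P^1(K)$, explicitly $\mathrm{diam}_G(\zeta_{a,r})=r/\max(1,|a|,r)^2$. $x\vee_G y$ is the first common point of $[x,\zeta_G]$ and $[y,\zeta_G]$;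 $d(x,y)=2\mathrm{diam}_G(x\vee_G y)-\mathrm{diam}_G(x)-\mathrm{diam}_G(y)$. Spherical metric $\|x,y\|=|x-y|/(\max(1,|x|)\max(1,|y|))$ on $K$, $\|x,\infty\|=1/\max(1,|x|)$. $\mathrm{Lip}_{\mathrm{Berk}}(\varphi)=\sup_{x\ne y\in\mathbf P^1_{\mathrm{Berk}}}d(\varphi x,\varphi y)/d(x,y)$, $\mathrm{Lip}_{\mathbf P^1(K)}(\varphi)=\sup_{x\ne y\in\mathbf P^1(K)}\|\varphi x,\varphi y\|/\|x,y\|$. $\mathrm{GIR}(\varphi)=\mathrm{diam}_G(\varphi(\zeta_G))$; $\mathrm{GPR}(\varphi)=\min\{\mathrm{diam}_G(x):\varphi(x)=\zeta_G\}$. For $a\in\mathbf P^1(K)$, $0<r<1$, $Q_{a,r}$ is the point of $[a,\zeta_G]$ with $\mathrm{diam}_G=r$, $\mathcal B(a,r)^-=\{x:Q_{a,r}\in(x,\zeta_G]\}$, $\mathcal B(a,1)^-=\bigcup_{r<1}\mathcal B(a,r)^-$; $B_0(\varphi)=\sup\{0<r\le1:\varphi(\mathcal B(a,r)^-)\ne\mathbf P^1_{\mathrm{Berk}}\ \forall a\in\mathbf P^1(K)\}$. A normalized representation of $\varphi$ of degree $d$ is a pair of homogeneous $F,G\in\mathcal O[X,Y]$ of degree $d$ without common factor, with some coefficient in $\mathcal O^\times$, with $\varphi([X:Y])=[F:G]$; $|\mathrm{Res}(\varphi)|=|\mathrm{Res}(F,G)|$ (Sylvester resultant), independent of the choice.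
   Formalization: The last expression is corrected to max(|a|,|b|,|c|,|e|)²/|ae−bc|: the printed formula without the square is not invariant under scaling the coefficients (it fails for φ(z)=λz/λ with |λ|≠1) and agrees with the corrected one exactly when the maximum is 1. *)

theory Defs
  imports Complex_Main "HOL-Computational_Algebra.Polynomial"
begin

definition nonarch_abs :: "('a::field \<Rightarrow> real) \<Rightarrow> bool" where
  "nonarch_abs v \<longleftrightarrow> (\<forall>x. 0 \<le> v x) \<and> (\<forall>x. v x = 0 \<longleftrightarrow> x = 0)
     \<and> (\<forall>x y. v (x * y) = v x * v y) \<and> (\<forall>x y. v (x + y) \<le> max (v x) (v y))"

definition nontrivial_abs :: "('a::field \<Rightarrow> real) \<Rightarrow> bool" where
  "nontrivial_abs v \<longleftrightarrow> (\<exists>x. x \<noteq> 0 \<and> v x \<noteq> 1)"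

definition complete_abs :: "('a::field \<Rightarrow> real) \<Rightarrow> bool" where
  "complete_abs v \<longleftrightarrow> (\<forall>X :: nat \<Rightarrow> 'a.
     (\<forall>\<epsilon>>0. \<exists>N. \<forall>m\<ge>N. \<forall>n\<ge>N. v (X m - X n) < \<epsilon>)
       \<longrightarrow> (\<exists>L. \<forall>\<epsilon>>0. \<exists>N. \<forall>n\<ge>N. v (X n - L) < \<epsilon>))"

definition alg_closed_field :: "'a::field itself \<Rightarrow> bool" where
  "alg_closed_field _ \<longleftrightarrow> (\<forall>p :: 'a poly. 1 \<le> degree p \<longrightarrow> (\<exists>x. poly p x = 0))"

definition valued_field_K :: "('a::field \<Rightarrow> real) \<Rightarrow> bool" where
  "valued_field_K v \<longleftrightarrow> nonarch_abs v \<and> nontrivial_abs v \<and> complete_abs v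
     \<and> alg_closed_field TYPE('a)"

text \<open>P^1(K) is \<open>'a option\<close>; \<open>None\<close> is the point \<open>\<infinity>\<close>.\<close>

fun chordal :: "('a::field \<Rightarrow> real) \<Rightarrow> 'a option \<Rightarrow> 'a option \<Rightarrow> real" where
  "chordal v (Some x) (Some y) = v (x - y) / (max 1 (v x) * max 1 (v y))"
| "chordal v (Some x) None = 1 / max 1 (v x)"
| "chordal v None (Some y) = 1 / max 1 (v y)"
| "chordal v None None = 0"

fun mob :: "'a::field \<Rightarrow> 'a \<Rightarrow> 'a \<Rightarrow> 'a \<Rightarrow> 'a option \<Rightarrow> 'a option" where
  "mob a b c e (Some z) = (if c * z + e = 0 then None else Some ((a * z + b) / (c * z + e)))"
| "mob a b c e None = (if c = 0 then None else Some (a / c))"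

definition Lip_P1 :: "('a::field \<Rightarrow> real) \<Rightarrow> 'a \<Rightarrow> 'a \<Rightarrow> 'a \<Rightarrow> 'a \<Rightarrow> real" where
  "Lip_P1 v a b c e = Sup {chordal v (mob a b c e x) (mob a b c e y) / chordal v x y | x y. x \<noteq> y}"

text \<open>Points of the Berkovich affine line: multiplicative seminorms on K[T] extending |.|.\<close>
definition berk_seminorm :: "('a::field \<Rightarrow> real) \<Rightarrow> ('a poly \<Rightarrow> real) \<Rightarrow> bool" where
  "berk_seminorm v s \<longleftrightarrow> (\<forall>f. 0 \<le> s f) \<and> (\<forall>c. s [:c:] = v c)
     \<and> (\<forall>f g. s (f * g) = s f * s g) \<and> (\<forall>f g. s (f + g) \<le> s f + s g)"

datatype 'n berk_ext = BFin 'n | BInf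

type_synonym 'a berk = "('a poly \<Rightarrow> real) berk_ext"

definition P1Berk :: "('a::field \<Rightarrow> real) \<Rightarrow> 'a berk set" where
  "P1Berk v = insert BInf (BFin ` {s. berk_seminorm v s})"

fun typeI :: "('a::field \<Rightarrow> real) \<Rightarrow> 'a option \<Rightarrow> 'a berk" where
  "typeI v (Some a) = BFin (\<lambda>f. v (poly f a))"
| "typeI v None = BInf"

definition zetaG :: "('a::field \<Rightarrow> real) \<Rightarrow> 'a berk" where
  "zetaG v = BFin (\<lambda>f. Max ((\<lambda>i. v (coeff f i)) ` {..degree f}))"

text \<open>Tree partial order rooted at \<infinity> (x below y iff y lies on [x, \<infinity>]).\<close>
fun berk_le :: "'a berk \<Rightarrow> 'a berk \<Rightarrow> bool" where
  "berk_le x BInf = True"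
| "berk_le BInf (BFin t) = False"
| "berk_le (BFin s) (BFin t) = (\<forall>f. s f \<le> t f)"

definition berk_join :: "('a::field \<Rightarrow> real) \<Rightarrow> 'a berk \<Rightarrow> 'a berk \<Rightarrow> 'a berk" where
  "berk_join v x y = (THE z. z \<in> P1Berk v \<and> berk_le x z \<and> berk_le y z
      \<and> (\<forall>w\<in>P1Berk v. berk_le x w \<and> berk_le y w \<longrightarrow> berk_le z w))"

definition seg :: "('a::field \<Rightarrow> real) \<Rightarrow> 'a berk \<Rightarrow> 'a berk \<Rightarrow> 'a berk set" where
  "seg v x y = {z \<in> P1Berk v. (berk_le x z \<and> berk_le z (berk_join v x y))
                            \<or> (berk_le y z \<and> berk_le z (berk_join v x y))}"

definition veeG :: "('a::field \<Rightarrow> real) \<Rightarrow> 'a berk \<Rightarrow> 'a berk \<Rightarrow> 'a berk" where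
  "veeG v x y = (THE w. w \<in> P1Berk v \<and> seg v w (zetaG v) = seg v x (zetaG v) \<inter> seg v y (zetaG v))"

text \<open>diam_G = q^(-rho(zeta_G, x)), written out: for zeta_{a,r}, this is r / max(1,|a|,r)^2;
  in seminorm terms r = inf_a x(T - a) and max(|a|,r) = x(T).\<close>
fun diamG :: "('a::field \<Rightarrow> real) \<Rightarrow> 'a berk \<Rightarrow> real" where
  "diamG v (BFin s) = (INF a. s [:- a, 1:]) / (max 1 (s [:0, 1:]))\<^sup>2"
| "diamG v BInf = 0"

definition berk_d :: "('a::field \<Rightarrow> real) \<Rightarrow> 'a berk \<Rightarrow> 'a berk \<Rightarrow> real" where
  "berk_d v x y = 2 * diamG v (veeG v x y) - diamG v x - diamG v y"

text \<open>Action of the Moebius map on the Berkovich line (pushforward of seminorms: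
  (phi_* s)(f) = s(f o phi), with f o phi = N_f / (cT+e)^(deg f)).\<close>
definition mob_num :: "'a::field \<Rightarrow> 'a \<Rightarrow> 'a \<Rightarrow> 'a \<Rightarrow> 'a poly \<Rightarrow> 'a poly" where
  "mob_num a b c e f = (\<Sum>i\<le>degree f. smult (coeff f i) ([:b, a:] ^ i * [:e, c:] ^ (degree f - i)))"

fun mob_berk :: "('a::field \<Rightarrow> real) \<Rightarrow> 'a \<Rightarrow> 'a \<Rightarrow> 'a \<Rightarrow> 'a \<Rightarrow> 'a berk \<Rightarrow> 'a berk" where
  "mob_berk v a b c e (BFin s) = (if s [:e, c:] = 0 then BInf
       else BFin (\<lambda>f. s (mob_num a b c e f) / s [:e, c:] ^ degree f))"
| "mob_berk v a b c e BInf = (if c = 0 then BInf else BFin (\<lambda>f. v (poly f (a / c))))"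

definition Lip_Berk :: "('a::field \<Rightarrow> real) \<Rightarrow> 'a \<Rightarrow> 'a \<Rightarrow> 'a \<Rightarrow> 'a \<Rightarrow> real" where
  "Lip_Berk v a b c e = Sup {berk_d v (mob_berk v a b c e x) (mob_berk v a b c e y) / berk_d v x y
      | x y. x \<in> P1Berk v \<and> y \<in> P1Berk v \<and> x \<noteq> y}"

definition GIR :: "('a::field \<Rightarrow> real) \<Rightarrow> 'a \<Rightarrow> 'a \<Rightarrow> 'a \<Rightarrow> 'a \<Rightarrow> real" where
  "GIR v a b c e = diamG v (mob_berk v a b c e (zetaG v))"

definition GPR :: "('a::field \<Rightarrow> real) \<Rightarrow> 'a \<Rightarrow> 'a \<Rightarrow> 'a \<Rightarrow> 'a \<Rightarrow> real" where
  "GPR v a b c e = Inf {diamG v x | x. x \<in> P1Berk v \<and> mob_berk v a b c e x = zetaG v}"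

definition Qpt :: "('a::field \<Rightarrow> real) \<Rightarrow> 'a option \<Rightarrow> real \<Rightarrow> 'a berk" where
  "Qpt v a r = (THE p. p \<in> seg v (typeI v a) (zetaG v) \<and> diamG v p = r)"

definition Bminus_lt :: "('a::field \<Rightarrow> real) \<Rightarrow> 'a option \<Rightarrow> real \<Rightarrow> 'a berk set" where
  "Bminus_lt v a r = {x \<in> P1Berk v. Qpt v a r \<in> seg v x (zetaG v) \<and> Qpt v a r \<noteq> x}"

definition Bminus :: "('a::field \<Rightarrow> real) \<Rightarrow> 'a option \<Rightarrow> real \<Rightarrow> 'a berk set" where
  "Bminus v a r = (if r < 1 then Bminus_lt v a r else (\<Union>r'\<in>{0<..<1}. Bminus_lt v a r'))"

definition B0 :: "('a::field \<Rightarrow> real) \<Rightarrow> 'a \<Rightarrow> 'a \<Rightarrow> 'a \<Rightarrow> 'a \<Rightarrow> real" where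
  "B0 v a b c e = Sup {r. 0 < r \<and> r \<le> 1 \<and>
      (\<forall>p. mob_berk v a b c e ` Bminus v p r \<noteq> P1Berk v)}"

text \<open>Sylvester resultant of the linear forms F = a X + b Y, G = c X + e Y:
  the determinant of the Sylvester matrix [[a,b],[c,e]].\<close>
definition sylv_res_lin :: "'a::field \<times> 'a \<times> 'a \<times> 'a \<Rightarrow> 'a" where
  "sylv_res_lin r = (case r of (a, b, c, e) \<Rightarrow> a * e - b * c)"

text \<open>Normalized representation of degree 1 of the map mob a b c e: coefficients in O,
  one of them a unit, no common factor (for linear forms: nonzero resultant), same map.\<close>
definition normalized_rep :: "('a::field \<Rightarrow> real) \<Rightarrow> 'a \<Rightarrow> 'a \<Rightarrow> 'a \<Rightarrow> 'a \<Rightarrow> 'a \<times> 'a \<times> 'a \<times> 'a \<Rightarrow> bool" where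
  "normalized_rep v a b c e r = (case r of (a', b', c', e') \<Rightarrow>
      v a' \<le> 1 \<and> v b' \<le> 1 \<and> v c' \<le> 1 \<and> v e' \<le> 1
      \<and> (v a' = 1 \<or> v b' = 1 \<or> v c' = 1 \<or> v e' = 1)
      \<and> sylv_res_lin (a', b', c', e') \<noteq> 0
      \<and> mob a' b' c' e' = mob a b c e)"

definition abs_Res :: "('a::field \<Rightarrow> real) \<Rightarrow> 'a \<Rightarrow> 'a \<Rightarrow> 'a \<Rightarrow> 'a \<Rightarrow> real" where
  "abs_Res v a b c e = v (sylv_res_lin (SOME r. normalized_rep v a b c e r))"

end

theory Submission
  imports Defs "HOL-Library.Product_Plus"
begin

text \<open>The value of a Berkovich point \<open>x\<close> at the linear form \<open>rT - p\<close> is, up to a constant, an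
  ultrametric seminorm \<open>N\<close> of \<open>(p, r) \<in> K\<^sup>2\<close>; scaled so that \<open>max (N (1, 0)) (N (0, 1)) = 1\<close>, it is
  the spherical kernel of \<open>x\<close>, and it determines \<open>x\<close>. The kernel of the Gauss point is the maximum
  norm, the tree rooted there is the pointwise order, joins are pointwise maxima, and \<open>diam\<^sub>G\<close> is the
  infimum of \<open>N x * N y\<close> over unimodular pairs. The Moebius map with matrix \<open>A\<close> pulls \<open>N\<close> back along
  the adjugate of \<open>A\<close> and divides by a constant \<open>h \<ge> |det A| / |A|\<close>, so it multiplies \<open>diam\<^sub>G\<close> by
  \<open>|det A| / h\<^sup>2\<close>. Since every kernel above \<open>N\<close> is the maximum of \<open>N\<close> and a multiple of the maximum
  norm, the Lipschitz bound \<open>|A|\<^sup>2 / |det A|\<close> is an explicit computation; it is attained on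
  \<open>P\<^sup>1(K)\<close>. Finally \<open>B\<^sub>0 = 1\<close> because the map is injective and no open ball contains the Gauss point.\<close>

section \<open>Nonarchimedean absolute values\<close>

lemma le_of_power_le_linear:
  fixes x M :: real
  assumes "0 \<le> M" and power_le: "\<And>n. x ^ n \<le> (real n + 1) * M ^ n"
  shows "x \<le> M"
proof (rule ccontr)
  assume "\<not> x \<le> M"
  hence "M < x" by simp
  moreover have "M \<noteq> 0" using power_le[of 1] \<open>M < x\<close> by auto
  ultimately have M: "0 < M" using \<open>0 \<le> M\<close> by simp
  define y where "y = x / M"
  have y: "1 < y" using \<open>M < x\<close> M by (simp add: y_def)
  have "y ^ n \<le> real n + 1" for n
    using power_le[of n] M by (simp add: y_def power_divide field_simps)
  hence lower: "1 \<le> real n / y ^ n + (1 / y) ^ n" for n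
    using y by (simp add: power_divide field_simps)
  have "(\<lambda>n. real n / y ^ n + (1 / y) ^ n) \<longlonglongrightarrow> 0 + 0"
    using y by (intro tendsto_add lim_n_over_pown LIMSEQ_realpow_zero) auto
  hence "1 \<le> (0::real)" using lower by (intro LIMSEQ_le_const[of _ 0 1]) auto
  thus False by simp
qed

lemma mult_less_mono_disj:
  fixes x y X Y :: real
  assumes "x \<le> X" "y \<le> Y" and "0 \<le> x" "0 \<le> y" "0 < X" "0 < Y" and less: "x < X \<or> y < Y"
  shows "x * y < X * Y"
  using less
proof
  assume "x < X"
  have "x * y \<le> x * Y" using assms by (intro mult_left_mono) auto
  also have "\<dots> < X * Y" using \<open>x < X\<close> \<open>0 < Y\<close> by simp
  finally show ?thesis .
next
  assume "y < Y"
  have "x * y \<le> X * y" using assms by (intro mult_right_mono) auto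
  also have "\<dots> < X * Y" using \<open>y < Y\<close> \<open>0 < X\<close> by simp
  finally show ?thesis .
qed

locale nonarch_field =
  fixes v :: "'a::field \<Rightarrow> real"
  assumes nonarch: "nonarch_abs v"
begin

lemma v_nonneg [simp]: "0 \<le> v x"
  and v_eq_0 [simp]: "v x = 0 \<longleftrightarrow> x = 0"
  and v_mult: "v (x * y) = v x * v y"
  and v_add: "v (x + y) \<le> max (v x) (v y)"
  using nonarch by (auto simp: nonarch_abs_def)

lemma v_0 [simp]: "v 0 = 0"
  by simp

lemma v_1 [simp]: "v 1 = 1"
  using v_mult[of 1 1] by (metis mult_cancel_right1 mult.right_neutral v_eq_0 zero_neq_one)

lemma v_pos_iff [simp]: "0 < v x \<longleftrightarrow> x \<noteq> 0"
  using v_nonneg[of x] v_eq_0[of x] by linarith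

lemma v_minus [simp]: "v (- x) = v x"
proof -
  have "v (-1) * v (-1) = 1" using v_mult[of "-1" "-1"] by simp
  hence "v (-1) = 1" using v_nonneg[of "-1"] by (simp add: square_eq_1_iff)
  thus ?thesis using v_mult[of "-1" x] by simp
qed

lemma v_diff: "v (x - y) \<le> max (v x) (v y)"
  using v_add[of x "- y"] by simp

lemma v_minus_commute: "v (x - y) = v (y - x)"
  using v_minus[of "x - y"] by simp

lemma v_divide: "v (x / y) = v x / v y"
proof (cases "y = 0")
  case False
  hence "v (x / y) * v y = v x" by (simp flip: v_mult)
  thus ?thesis using False by (simp add: field_simps)
qed simp

lemma v_power: "v (x ^ n) = v x ^ n"
  by (induction n) (auto simp: v_mult)

lemma v_add_eq_max:
  assumes "v y < v x"
  shows "v (x + y) = v x"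
  using v_add[of x y] v_diff[of "x + y" y] assms by auto

lemma v_sum_le:
  assumes "\<And>i. i \<in> I \<Longrightarrow> v (f i) \<le> B" "0 \<le> B"
  shows "v (sum f I) \<le> B"
  using assms
proof (induction I rule: infinite_finite_induct)
  case (insert x F)
  thus ?case using v_add[of "f x" "sum f F"] by fastforce
qed auto

lemma v_sum_less:
  assumes "\<And>i. i \<in> I \<Longrightarrow> v (f i) < B" "0 < B"
  shows "v (sum f I) < B"
  using assms
proof (induction I rule: infinite_finite_induct)
  case (insert x F)
  thus ?case using v_add[of "f x" "sum f F"] by fastforce
qed auto

lemma v_sum_eq_dominant:
  assumes I: "finite I" "i \<in> I" and "f i \<noteq> 0" and less: "\<And>k. k \<in> I - {i} \<Longrightarrow> v (f k) < v (f i)"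
  shows "v (sum f I) = v (f i)"
proof -
  have "v (sum f (I - {i})) < v (f i)" using \<open>f i \<noteq> 0\<close> by (intro v_sum_less less) auto
  thus ?thesis using v_add_eq_max by (simp add: sum.remove[OF I])
qed

lemma v_of_nat: "v (of_nat n) \<le> 1"
proof (induction n)
  case (Suc n)
  thus ?case using v_add[of 1 "of_nat n"] by auto
qed simp

end

section \<open>Ultrametric seminorms on the plane\<close>

definition scale :: "'a::comm_ring_1 \<Rightarrow> 'a \<times> 'a \<Rightarrow> 'a \<times> 'a" (infixr \<open>\<odot>\<close> 75) where
  "k \<odot> x = (k * fst x, k * snd x)"

definition wedge :: "'a::comm_ring_1 \<times> 'a \<Rightarrow> 'a \<times> 'a \<Rightarrow> 'a" where
  "wedge x y = fst x * snd y - snd x * fst y"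

lemma fst_scale [simp]: "fst (k \<odot> x) = k * fst x"
  and snd_scale [simp]: "snd (k \<odot> x) = k * snd x"
  by (simp_all add: scale_def)

lemma scale_Pair [simp]: "k \<odot> (p, r) = (k * p, k * r)"
  by (simp add: scale_def)

lemma scale_scale [simp]: "k \<odot> l \<odot> x = (k * l) \<odot> x"
  by (simp add: scale_def mult.assoc)

lemma scale_one [simp]: "1 \<odot> x = x"
  by (simp add: scale_def)

lemma wedge_self [simp]: "wedge x x = 0"
  by (simp add: wedge_def mult.commute)

lemma wedge_axes [simp]:
  "wedge x (1, 0) = - snd x" "wedge x (0, 1) = fst x"
  "wedge (1, 0) x = snd x" "wedge (0, 1) x = - fst x"
  by (simp_all add: wedge_def)

lemma wedge_scale: "wedge (k \<odot> x) (l \<odot> y) = k * l * wedge x y"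
  by (simp add: wedge_def algebra_simps)

lemma wedge_commute: "wedge y x = - wedge x y"
  by (simp add: wedge_def mult.commute)

lemma cramer_plane: "wedge x y \<odot> z = wedge z y \<odot> x + wedge x z \<odot> y"
  by (simp add: prod_eq_iff wedge_def algebra_simps)

context nonarch_field
begin

definition ultra_seminorm :: "('a \<times> 'a \<Rightarrow> real) \<Rightarrow> bool" where
  "ultra_seminorm N \<longleftrightarrow> (\<forall>k x. N (k \<odot> x) = v k * N x) \<and> (\<forall>x y. N (x + y) \<le> max (N x) (N y))"

definition max_norm :: "'a \<times> 'a \<Rightarrow> real" where
  "max_norm x = max (v (fst x)) (v (snd x))"

definition height :: "('a \<times> 'a \<Rightarrow> real) \<Rightarrow> real" where
  "height N = max (N (1, 0)) (N (0, 1))"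

definition thicken :: "('a \<times> 'a \<Rightarrow> real) \<Rightarrow> real \<Rightarrow> 'a \<times> 'a \<Rightarrow> real" where
  "thicken N t x = max (N x) (t * max_norm x)"

lemma ultra_scale: "ultra_seminorm N \<Longrightarrow> N (k \<odot> x) = v k * N x"
  and ultra_add: "ultra_seminorm N \<Longrightarrow> N (x + y) \<le> max (N x) (N y)"
  unfolding ultra_seminorm_def by blast+

lemma ultra_minus: "ultra_seminorm N \<Longrightarrow> N (- x) = N x"
  using ultra_scale[of N "-1" x] by (simp add: scale_def uminus_prod_def)

lemma ultra_diff: "ultra_seminorm N \<Longrightarrow> N (x - y) \<le> max (N x) (N y)"
  using ultra_add[of N x "- y"] by (simp add: ultra_minus)

lemma ultra_nonneg: "ultra_seminorm N \<Longrightarrow> 0 \<le> N x"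
  using ultra_diff[of N x x] ultra_scale[of N 0 x] by (simp add: scale_def zero_prod_def)

lemma ultra_zero: "ultra_seminorm N \<Longrightarrow> N 0 = 0"
  using ultra_scale[of N 0 0] by (simp add: scale_def zero_prod_def)

lemma ultra_add_eq_max:
  assumes N: "ultra_seminorm N" and "N y < N x"
  shows "N (x + y) = N x"
  using ultra_add[OF N, of x y] ultra_diff[OF N, of "x + y" y] assms by auto

lemma ultra_axes:
  assumes "ultra_seminorm N"
  shows "N (p, 0) = v p * N (1, 0)" "N (0, r) = v r * N (0, 1)"
  using ultra_scale[OF assms, of p "(1, 0)"] ultra_scale[OF assms, of r "(0, 1)"] by simp_all

lemma ptolemy:
  assumes N: "ultra_seminorm N"
  shows "v (wedge x y) * N z \<le> max (v (wedge z y) * N x) (v (wedge x z) * N y)"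
  using ultra_add[OF N, of "wedge z y \<odot> x" "wedge x z \<odot> y"]
  by (simp flip: cramer_plane add: ultra_scale[OF N])

lemma height_nonneg: "ultra_seminorm N \<Longrightarrow> 0 \<le> height N"
  by (simp add: height_def le_max_iff_disj ultra_nonneg)

lemma height_mult: "0 \<le> t \<Longrightarrow> height (\<lambda>x. t * N x) = t * height N"
  by (simp add: height_def max_mult_distrib_left)

lemma max_norm_axes [simp]: "max_norm (1, 0) = 1" "max_norm (0, 1) = 1"
  by (simp_all add: max_norm_def)

lemma ultra_max_norm: "ultra_seminorm max_norm"
  unfolding ultra_seminorm_def
proof (intro conjI allI)
  fix k x y
  show "max_norm (k \<odot> x) = v k * max_norm x"
    by (simp add: max_norm_def v_mult max_mult_distrib_left)
  show "max_norm (x + y) \<le> max (max_norm x) (max_norm y)"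
    using v_add[of "fst x" "fst y"] v_add[of "snd x" "snd y"] by (auto simp: max_norm_def)
qed

lemma max_norm_nonneg [simp]: "0 \<le> max_norm x"
  by (rule ultra_nonneg[OF ultra_max_norm])

lemma max_norm_pos_iff [simp]: "0 < max_norm x \<longleftrightarrow> x \<noteq> 0"
  by (cases x) (auto simp: max_norm_def less_max_iff_disj zero_prod_def)

lemma height_max_norm: "height max_norm = 1"
  by (simp add: height_def)

lemma ultra_le_height:
  assumes N: "ultra_seminorm N"
  shows "N x \<le> height N * max_norm x"
proof -
  have "N x \<le> max (v (fst x) * N (1, 0)) (v (snd x) * N (0, 1))"
    using ultra_add[OF N, of "(fst x, 0)" "(0, snd x)"] by (simp add: ultra_axes[OF N, symmetric])
  also have "\<dots> \<le> max_norm x * height N"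
    by (intro max.boundedI mult_mono) (auto simp: max_norm_def height_def ultra_nonneg[OF N]
        le_max_iff_disj)
  finally show ?thesis by (simp add: mult.commute)
qed

lemma ultra_sup:
  assumes N: "ultra_seminorm N" and M: "ultra_seminorm M"
  shows "ultra_seminorm (\<lambda>x. max (N x) (M x))"
  unfolding ultra_seminorm_def
proof (intro conjI allI)
  fix k x y
  show "max (N (k \<odot> x)) (M (k \<odot> x)) = v k * max (N x) (M x)"
    by (simp add: ultra_scale[OF N] ultra_scale[OF M] max_mult_distrib_left)
  show "max (N (x + y)) (M (x + y)) \<le> max (max (N x) (M x)) (max (N y) (M y))"
    using ultra_add[OF N, of x y] ultra_add[OF M, of x y] by auto
qed

lemma ultra_mult:
  assumes N: "ultra_seminorm N" and "0 \<le> t"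
  shows "ultra_seminorm (\<lambda>x. t * N x)"
  unfolding ultra_seminorm_def
proof (intro conjI allI)
  fix k x y
  show "t * N (k \<odot> x) = v k * (t * N x)" by (simp add: ultra_scale[OF N])
  have "t * N (x + y) \<le> t * max (N x) (N y)" using \<open>0 \<le> t\<close> by (intro mult_left_mono ultra_add N)
  thus "t * N (x + y) \<le> max (t * N x) (t * N y)" using \<open>0 \<le> t\<close> by (simp add: max_mult_distrib_left)
qed

lemma ultra_comp:
  assumes N: "ultra_seminorm N"
    and A: "\<And>k x. A (k \<odot> x) = k \<odot> A x" "\<And>x y. A (x + y) = A x + A y"
  shows "ultra_seminorm (N \<circ> A)"
  using ultra_scale[OF N] ultra_add[OF N] by (simp add: ultra_seminorm_def A)

lemma ultra_thicken:
  assumes N: "ultra_seminorm N" and "0 \<le> t"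
  shows "ultra_seminorm (thicken N t)"
  unfolding thicken_def[abs_def]
  by (intro ultra_sup N ultra_mult ultra_max_norm \<open>0 \<le> t\<close>)

lemma thicken_mono: "s \<le> t \<Longrightarrow> thicken N s x \<le> thicken N t x"
  unfolding thicken_def by (intro max.mono mult_right_mono) auto

subsection \<open>Diameter and covolume\<close>

definition diam :: "('a \<times> 'a \<Rightarrow> real) \<Rightarrow> real" where
  "diam N = (INF x\<in>{x. max_norm x = 1}. N x)"

definition covol :: "('a \<times> 'a \<Rightarrow> real) \<Rightarrow> real" where
  "covol N = Inf {N x * N y | x y. v (wedge x y) = 1}"

lemma diam_le: "ultra_seminorm N \<Longrightarrow> max_norm x = 1 \<Longrightarrow> diam N \<le> N x"
  unfolding diam_def by (intro cINF_lower bdd_belowI[of _ 0]) (auto simp: ultra_nonneg)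

lemma diam_ge: "(\<And>x. max_norm x = 1 \<Longrightarrow> B \<le> N x) \<Longrightarrow> B \<le> diam N"
  unfolding diam_def by (intro cINF_greatest) (use max_norm_axes in blast)+

lemma diam_nonneg: "ultra_seminorm N \<Longrightarrow> 0 \<le> diam N"
  by (intro diam_ge ultra_nonneg)

lemma diam_max_norm: "diam max_norm = 1"
  using diam_le[OF ultra_max_norm max_norm_axes(1)] diam_ge[of 1 max_norm] by simp

lemma diam_mono:
  assumes "ultra_seminorm N" and below: "\<And>x. N x \<le> M x"
  shows "diam N \<le> diam M"
  using diam_le[OF assms(1)] below by (intro diam_ge) (meson order_trans)

lemma scaled_unit_vector:
  assumes "x \<noteq> 0"
  obtains k y where "x = k \<odot> y" "v k = max_norm x" "max_norm y = 1"
proof -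
  obtain k where k: "v k = max_norm x" by (cases "v (fst x) \<le> v (snd x)") (auto simp: max_norm_def)
  hence "k \<noteq> 0" using assms max_norm_pos_iff[of x] by force
  hence x: "x = k \<odot> (1 / k) \<odot> x" by simp
  have "max_norm x = v k * max_norm ((1 / k) \<odot> x)"
    by (subst x) (simp only: ultra_scale[OF ultra_max_norm, of k])
  hence "max_norm ((1 / k) \<odot> x) = 1" using k \<open>k \<noteq> 0\<close> by (metis mult_cancel_left2 v_eq_0)
  with k x show thesis by (intro that)
qed

lemma diam_mult_le:
  assumes N: "ultra_seminorm N"
  shows "diam N * max_norm x \<le> N x"
proof (cases "x = 0")
  case False
  then obtain k y where xy: "x = k \<odot> y" "v k = max_norm x" "max_norm y = 1"
    by (rule scaled_unit_vector)
  have "v k * diam N \<le> v k * N y" using diam_le[OF N xy(3)] by (intro mult_left_mono) auto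
  also have "\<dots> = N x" unfolding xy(1) by (rule ultra_scale[OF N, symmetric])
  finally show ?thesis by (simp add: xy(2) mult.commute)
qed (simp add: ultra_zero[OF N] max_norm_def)

lemma diam_thicken:
  assumes N: "ultra_seminorm N" and "0 \<le> t"
  shows "diam (thicken N t) = max (diam N) t"
proof (rule antisym)
  show "max (diam N) t \<le> diam (thicken N t)"
    by (rule diam_ge) (auto simp: thicken_def dest: diam_le[OF N])
  show "diam (thicken N t) \<le> max (diam N) t"
  proof (cases "diam (thicken N t) \<le> t")
    case False
    have "diam (thicken N t) \<le> diam N"
    proof (rule diam_ge)
      fix x assume x: "max_norm x = 1"
      show "diam (thicken N t) \<le> N x"
        using diam_le[OF ultra_thicken[OF assms] x] False x by (auto simp: thicken_def)
    qed
    thus ?thesis by simp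
  qed simp
qed

lemma covol_le:
  assumes N: "ultra_seminorm N"
  shows "covol N * v (wedge x y) \<le> N x * N y"
proof (cases "wedge x y = 0")
  case False
  define d where "d = wedge x y"
  have d: "d \<noteq> 0" using False by (simp add: d_def)
  have "wedge ((1 / d) \<odot> x) y = 1" using wedge_scale[of "1 / d" x 1 y] d
    by (simp add: d_def[symmetric])
  hence "covol N \<le> N ((1 / d) \<odot> x) * N y"
    unfolding covol_def using ultra_nonneg[OF N]
    by (intro cInf_lower bdd_belowI[of _ 0]) (metis (mono_tags, lifting) mem_Collect_eq v_1, auto)
  thus ?thesis using d by (simp add: ultra_scale[OF N] v_divide field_simps d_def[symmetric])
qed (simp add: ultra_nonneg[OF N])

lemma covol_ge:
  assumes "\<And>x y. v (wedge x y) = 1 \<Longrightarrow> B \<le> N x * N y"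
  shows "B \<le> covol N"
  unfolding covol_def
proof (rule cInf_greatest)
  have "v (wedge (1, 0) (0, 1)) = 1" by simp
  thus "{N x * N y | x y. v (wedge x y) = 1} \<noteq> {}" by blast
qed (use assms in blast)

lemma covol_mult:
  assumes N: "ultra_seminorm N" and t: "0 < t"
  shows "covol (\<lambda>x. t * N x) = t\<^sup>2 * covol N"
proof (rule antisym)
  have ultra_tN: "ultra_seminorm (\<lambda>x. t * N x)" using N t by (intro ultra_mult) auto
  have "covol (\<lambda>x. t * N x) / t\<^sup>2 \<le> covol N"
  proof (rule covol_ge)
    fix x y assume "v (wedge x y) = 1"
    hence "covol (\<lambda>x. t * N x) \<le> (t * N x) * (t * N y)" using covol_le[OF ultra_tN, of x y] by simp
    thus "covol (\<lambda>x. t * N x) / t\<^sup>2 \<le> N x * N y" using t by (simp add: field_simps power2_eq_square)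
  qed
  thus "covol (\<lambda>x. t * N x) \<le> t\<^sup>2 * covol N" using t by (simp add: field_simps)
  show "t\<^sup>2 * covol N \<le> covol (\<lambda>x. t * N x)"
  proof (rule covol_ge)
    fix x y assume "v (wedge x y) = 1"
    hence "covol N \<le> N x * N y" using covol_le[OF N, of x y] by simp
    hence "t\<^sup>2 * covol N \<le> t\<^sup>2 * (N x * N y)" by (intro mult_left_mono) auto
    thus "t\<^sup>2 * covol N \<le> (t * N x) * (t * N y)" by (simp add: power2_eq_square mult_ac)
  qed
qed

lemma covol_comp_ge:
  assumes N: "ultra_seminorm N" and A: "\<And>x y. wedge (A x) (A y) = d * wedge x y"
  shows "v d * covol N \<le> covol (N \<circ> A)"
proof (rule covol_ge)
  fix x y assume "v (wedge x y) = 1"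
  thus "v d * covol N \<le> (N \<circ> A) x * (N \<circ> A) y"
    using covol_le[OF N, of "A x" "A y"] by (simp add: A v_mult mult.commute)
qed

lemma wedge_mult_height_le:
  assumes N: "ultra_seminorm N"
  shows "v (wedge x y) * height N \<le> max (max_norm y * N x) (max_norm x * N y)"
proof -
  have "v (wedge x y) * N z \<le> max (max_norm y * N x) (max_norm x * N y)"
    if "z \<in> {(1, 0), (0, 1)}" for z
  proof -
    have "v (wedge z y) \<le> max_norm y" "v (wedge x z) \<le> max_norm x" using that
      by (auto simp: max_norm_def)
    hence "max (v (wedge z y) * N x) (v (wedge x z) * N y)
        \<le> max (max_norm y * N x) (max_norm x * N y)"
      by (intro max.mono mult_right_mono ultra_nonneg[OF N])
    with ptolemy[OF N, of x y z] show ?thesis by (rule order_trans)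
  qed
  thus ?thesis by (simp add: height_def max_mult_distrib_left)
qed

lemma unimodular_axis:
  assumes "max_norm x = 1"
  obtains y where "y \<in> {(1, 0), (0, 1)}" "v (wedge x y) = 1"
proof (cases "v (fst x) = 1")
  case True
  thus thesis by (intro that[of "(0, 1)"]) simp_all
next
  case False
  hence "v (snd x) = 1" using assms by (auto simp: max_norm_def max_def split: if_splits)
  thus thesis by (intro that[of "(1, 0)"]) simp_all
qed

lemma covol_le_mult_height:
  assumes N: "ultra_seminorm N" and "max_norm x = 1"
  shows "covol N \<le> N x * height N"
proof -
  obtain y where y: "y \<in> {(1, 0), (0, 1)}" "v (wedge x y) = 1"
    using \<open>max_norm x = 1\<close> by (rule unimodular_axis)
  have "covol N \<le> N x * N y" using covol_le[OF N, of x y] y(2) by simp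
  also have "\<dots> \<le> N x * height N"
    using y(1) by (intro mult_left_mono ultra_nonneg[OF N]) (auto simp: height_def)
  finally show ?thesis .
qed

lemma covol_eq_diam_height:
  assumes N: "ultra_seminorm N"
  shows "covol N = diam N * height N"
proof (rule antisym)
  show "covol N \<le> diam N * height N"
  proof (cases "height N = 0")
    case True
    thus ?thesis using covol_le_mult_height[OF N, of "(1, 0)"] by simp
  next
    case False
    hence pos: "0 < height N" using height_nonneg[OF N] by simp
    have "covol N / height N \<le> diam N"
      using covol_le_mult_height[OF N] pos by (intro diam_ge) (simp add: pos_divide_le_eq)
    thus ?thesis using pos by (simp add: pos_divide_le_eq)
  qed
  show "diam N * height N \<le> covol N"
  proof (rule covol_ge)
    fix x y assume "v (wedge x y) = 1"
    hence "diam N * height N \<le> diam N * max (max_norm y * N x) (max_norm x * N y)"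
      using wedge_mult_height_le[OF N, of x y] by (intro mult_left_mono diam_nonneg N) simp
    also have "\<dots> = max ((diam N * max_norm y) * N x) ((diam N * max_norm x) * N y)"
      using diam_nonneg[OF N] by (simp add: max_mult_distrib_left mult.assoc)
    also have "\<dots> \<le> max (N y * N x) (N x * N y)"
      by (intro max.mono mult_right_mono diam_mult_le N ultra_nonneg)
    finally show "diam N * height N \<le> N x * N y" by (simp add: mult.commute)
  qed
qed

lemma covol_eq_INF:
  assumes N: "ultra_seminorm N" and axis: "N (1, 0) = 1"
  shows "covol N = (INF a. N (a, 1))"
proof (rule antisym)
  show "covol N \<le> (INF a. N (a, 1))"
  proof (rule cINF_greatest)
    fix a
    show "covol N \<le> N (a, 1)" using covol_le[OF N, of "(a, 1)" "(1, 0)"] by (simp add: axis)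
  qed simp
  define I where "I = (INF a. N (a, 1))"
  have bdd: "bdd_below (range (\<lambda>a. N (a, 1)))"
    by (intro bdd_belowI[of _ 0]) (auto simp: ultra_nonneg[OF N])
  have I_nonneg: "0 \<le> I" unfolding I_def by (rule cINF_greatest) (auto simp: ultra_nonneg[OF N])
  have I: "I * v (snd x) \<le> N x" for x
  proof (cases "snd x = 0")
    case False
    hence x: "snd x \<odot> (fst x / snd x, 1) = x" by (simp add: prod_eq_iff)
    have "v (snd x) * I \<le> v (snd x) * N (fst x / snd x, 1)"
      unfolding I_def by (intro mult_left_mono cINF_lower bdd) auto
    also have "\<dots> = N x" unfolding ultra_scale[OF N, symmetric] x ..
    finally show ?thesis by (simp add: mult.commute)
  qed (simp add: ultra_nonneg[OF N])
  show "I \<le> covol N"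
  proof (rule covol_ge)
    fix x y assume "v (wedge x y) = 1"
    hence "I \<le> I * max (v (snd y) * N x) (v (snd x) * N y)"
      using mult_left_mono[OF ptolemy[OF N, of x y "(1, 0)"] I_nonneg] by (simp add: axis)
    also have "\<dots> = max ((I * v (snd y)) * N x) ((I * v (snd x)) * N y)"
      using I_nonneg by (simp add: max_mult_distrib_left mult.assoc)
    also have "\<dots> \<le> max (N y * N x) (N x * N y)"
      by (intro max.mono mult_right_mono I ultra_nonneg N)
    finally show "I \<le> N x * N y" by (simp add: mult.commute)
  qed
qed

subsection \<open>Normalized seminorms\<close>

definition normed :: "('a \<times> 'a \<Rightarrow> real) \<Rightarrow> 'a \<times> 'a \<Rightarrow> real" where
  "normed N x = N x / height N"

definition unit_seminorm :: "('a \<times> 'a \<Rightarrow> real) \<Rightarrow> bool" where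
  "unit_seminorm N \<longleftrightarrow> ultra_seminorm N \<and> height N = 1"

lemma unit_ultra: "unit_seminorm N \<Longrightarrow> ultra_seminorm N"
  and unit_height: "unit_seminorm N \<Longrightarrow> height N = 1"
  by (auto simp: unit_seminorm_def)

lemma unit_le: "unit_seminorm N \<Longrightarrow> N x \<le> max_norm x"
  using ultra_le_height[of N x] by (simp add: unit_seminorm_def)

lemma unit_max_norm: "unit_seminorm max_norm"
  by (simp add: unit_seminorm_def ultra_max_norm height_max_norm)

lemma unit_sup: "unit_seminorm N \<Longrightarrow> unit_seminorm M \<Longrightarrow> unit_seminorm (\<lambda>x. max (N x) (M x))"
  by (auto simp: unit_seminorm_def ultra_sup height_def)

lemma unit_thicken:
  assumes "unit_seminorm N" "0 \<le> t" "t \<le> 1"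
  shows "unit_seminorm (thicken N t)"
  using assms by (auto simp: unit_seminorm_def ultra_thicken height_def thicken_def)

lemma unit_normed:
  assumes N: "ultra_seminorm N" and "0 < height N"
  shows "unit_seminorm (normed N)"
  using ultra_mult[OF N, of "1 / height N"] height_mult[of "1 / height N" N] \<open>0 < height N\<close>
  by (simp add: unit_seminorm_def normed_def[abs_def])

lemma normed_unit: "unit_seminorm N \<Longrightarrow> normed N = N"
  by (simp add: normed_def fun_eq_iff unit_height)

lemma normed_mult:
  assumes "0 < t"
  shows "normed (\<lambda>x. t * N x) = normed N"
  using assms by (simp add: normed_def fun_eq_iff height_mult)

lemma normed_normed_comp:
  assumes "0 < height N"
  shows "normed (normed N \<circ> A) = normed (N \<circ> A)"
  using normed_mult[of "1 / height N" "N \<circ> A"] assms by (simp add: normed_def[of N] comp_def)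

lemma diam_normed:
  assumes N: "ultra_seminorm N" and "0 < height N"
  shows "diam (normed N) = covol N / (height N)\<^sup>2"
proof -
  note ultra = unit_normed[OF assms]
  have "diam (normed N) = covol (\<lambda>x. (1 / height N) * N x)"
    using covol_eq_diam_height[OF unit_ultra[OF ultra]] unfolding unit_height[OF ultra]
    by (simp add: normed_def[abs_def])
  also have "\<dots> = covol N / (height N)\<^sup>2"
    using covol_mult[OF N, of "1 / height N"] \<open>0 < height N\<close> by (simp add: power_divide)
  finally show ?thesis .
qed

lemma diam_unit_le:
  assumes N: "unit_seminorm N"
  shows "diam N \<le> N (1, 0)"
  using unit_ultra[OF N] by (rule diam_le) simp

lemma diam_unit_le_1:
  assumes N: "unit_seminorm N"
  shows "diam N \<le> 1"
  using diam_unit_le[OF N] unit_le[OF N, of "(1, 0)"] by simp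

lemma unit_eq_v_snd:
  assumes N: "unit_seminorm N" and axis: "N (1, 0) = 0"
  shows "N = v \<circ> snd"
proof
  fix x
  note ultra = unit_ultra[OF N]
  have axis2: "N (0, 1) = 1" using unit_height[OF N] ultra_nonneg[OF ultra, of "(0, 1)"]
    by (simp add: height_def axis)
  have axes: "N (fst x, 0) = 0" "N (0, snd x) = v (snd x)"
    using ultra_axes(1)[OF ultra, of "fst x"] ultra_axes(2)[OF ultra, of "snd x"]
    by (simp_all add: axis axis2)
  have "N x \<le> max (N (fst x, 0)) (N (0, snd x))"
    using ultra_add[OF ultra, of "(fst x, 0)" "(0, snd x)"] by simp
  moreover have "N (0, snd x) \<le> max (N x) (N (fst x, 0))"
    using ultra_diff[OF ultra, of x "(fst x, 0)"] by (simp add: minus_prod_def)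
  ultimately show "N x = (v \<circ> snd) x" using ultra_nonneg[OF ultra, of x] by (simp add: axes)
qed

subsection \<open>The tree of normalized seminorms\<close>

text \<open>All three inequalities are Ptolemy's. With \<open>N y = 1\<close> for an axis vector \<open>y\<close> they show that
  \<open>M z0 < 1\<close> forces \<open>|wedge y z0| = 1\<close>, that \<open>M z \<le> |wedge z z0|\<close>, and that \<open>|wedge z z0| \<le> N z\<close>.\<close>

lemma unit_eq_of_smaller_value:
  assumes N: "unit_seminorm N" and M: "unit_seminorm M" and below: "\<And>x. N x \<le> M x"
    and z: "max_norm z = 1" and z0: "max_norm z0 = 1" and less: "M z0 < M z"
  shows "N z = M z"
proof -
  note ultra_N = unit_ultra[OF N] and ultra_M = unit_ultra[OF M]
  have M_le_1: "M x \<le> 1" if "max_norm x = 1" for x using unit_le[OF M, of x] that by simp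
  have wedge_le_1: "v (wedge x y) \<le> 1" if "max_norm x = 1" "max_norm y = 1" for x y
    using wedge_mult_height_le[OF ultra_max_norm, of x y] that by (simp add: height_max_norm)
  obtain y where y: "max_norm y = 1" "N y = 1"
    using unit_height[OF N] by (metis height_def max_def max_norm_axes)
  hence M_y: "M y = 1" using below[of y] M_le_1[of y] by simp
  obtain x where x: "max_norm x = 1" "v (wedge x z0) = 1"
    using unimodular_axis[OF z0] by (metis insertE max_norm_axes singletonD v_minus wedge_commute)
  have M_z0: "M z0 < 1" using less M_le_1[OF z] by simp
  have wedge_y_z0: "v (wedge y z0) = 1"
  proof -
    have "1 \<le> max (v (wedge y z0) * M x) (v (wedge x y) * M z0)"
      using ptolemy[OF ultra_M, of x z0 y] by (simp add: x M_y)
    moreover have "v (wedge x y) * M z0 < 1"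
      using mult_right_mono[OF wedge_le_1[OF x(1) y(1)], of "M z0"] M_z0
        ultra_nonneg[OF ultra_M, of z0] by simp
    moreover have "v (wedge y z0) * M x \<le> v (wedge y z0) * 1"
      by (intro mult_left_mono M_le_1 x) simp
    ultimately show ?thesis using wedge_le_1[OF y(1) z0] by auto
  qed
  have small: "v (wedge y z) * P z0 < M z" if "P z0 \<le> M z0" "0 \<le> P z0" for P :: "'a \<times> 'a \<Rightarrow> real"
    using mult_right_mono[OF wedge_le_1[OF y(1) z] that(2)] that(1) less by simp
  have "M z \<le> v (wedge z z0)"
    using ptolemy[OF ultra_M, of y z0 z] small[of M] ultra_nonneg[OF ultra_M, of z0]
    by (auto simp: wedge_y_z0 M_y)
  also have "v (wedge z z0) \<le> N z"
    using ptolemy[OF ultra_N, of z z0 y] small[of N] below[of z0] ultra_nonneg[OF ultra_N, of z0]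
      calculation
    by (auto simp: wedge_y_z0 y v_minus_commute wedge_commute[of y z])
  finally show ?thesis using below[of z] by simp
qed

lemma unit_eq_thicken:
  assumes N: "unit_seminorm N" and M: "unit_seminorm M" and below: "\<And>x. N x \<le> M x"
  shows "M = thicken N (diam M)"
proof
  fix x
  note ultra_N = unit_ultra[OF N] and ultra_M = unit_ultra[OF M]
  have unit: "M x = max (N x) (diam M)" if x: "max_norm x = 1" for x
  proof (cases "M x \<le> diam M")
    case True
    thus ?thesis using diam_le[OF ultra_M x] below[of x] by simp
  next
    case False
    then obtain y where "max_norm y = 1" "M y < M x" using diam_ge[of "M x" M] by (meson not_le)
    with unit_eq_of_smaller_value[OF N M below x] False show ?thesis by auto
  qed
  show "M x = thicken N (diam M) x"
  proof (cases "x = 0")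
    case False
    then obtain k y where xy: "x = k \<odot> y" "v k = max_norm x" "max_norm y = 1"
      by (rule scaled_unit_vector)
    have "M x = v k * max (N y) (diam M)" unfolding xy(1) ultra_scale[OF ultra_M] unit[OF xy(3)] ..
    also have "\<dots> = thicken N (diam M) x"
      unfolding thicken_def xy(2)[symmetric] unfolding xy(1) ultra_scale[OF ultra_N]
      by (simp add: max_mult_distrib_left mult.commute)
    finally show ?thesis .
  qed (simp add: ultra_zero[OF ultra_M] ultra_zero[OF ultra_N] thicken_def max_norm_def)
qed

definition tree_dist :: "('a \<times> 'a \<Rightarrow> real) \<Rightarrow> ('a \<times> 'a \<Rightarrow> real) \<Rightarrow> real" where
  "tree_dist N M = 2 * diam (\<lambda>x. max (N x) (M x)) - diam N - diam M"

lemma tree_dist_commute: "tree_dist N M = tree_dist M N"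
  by (simp add: tree_dist_def max.commute)

lemma tree_dist_nonneg:
  assumes "ultra_seminorm N" and "ultra_seminorm M"
  shows "0 \<le> tree_dist N M"
proof -
  have "diam N \<le> diam (\<lambda>x. max (N x) (M x))" "diam M \<le> diam (\<lambda>x. max (N x) (M x))"
    using assms by (auto intro!: diam_mono)
  thus ?thesis by (simp add: tree_dist_def)
qed

text \<open>The seminorms above \<open>P\<close> form a chain, so one of the two joins with \<open>P\<close> dominates the other.\<close>

lemma diam_sup_le_max:
  assumes N: "unit_seminorm N" and P: "unit_seminorm P" and M: "unit_seminorm M"
  shows "diam (\<lambda>x. max (N x) (M x)) \<le> max (diam (\<lambda>x. max (N x) (P x))) (diam (\<lambda>x. max (P x) (M x)))"
    (is "diam ?J \<le> max (diam ?A) (diam ?B)")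
proof -
  have A: "?A = thicken P (diam ?A)" and B: "?B = thicken P (diam ?B)"
    by (rule unit_eq_thicken[OF P], auto intro: unit_sup N P M)+
  have J: "ultra_seminorm ?J" by (intro unit_ultra unit_sup N M)
  show ?thesis
  proof (cases "diam ?A \<le> diam ?B")
    case True
    hence "?A x \<le> ?B x" for x using thicken_mono[OF True, of P x] A B by metis
    hence "N x \<le> ?B x" for x using max.boundedE by blast
    hence "diam ?J \<le> diam ?B" by (intro diam_mono[OF J] max.boundedI) auto
    thus ?thesis by simp
  next
    case False
    hence "?B x \<le> ?A x" for x using thicken_mono[of "diam ?B" "diam ?A" P x] A B by (metis linear)
    hence "M x \<le> ?A x" for x using max.boundedE by blast
    hence "diam ?J \<le> diam ?A" by (intro diam_mono[OF J] max.boundedI) auto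
    thus ?thesis by simp
  qed
qed

lemma tree_dist_triangle:
  assumes N: "unit_seminorm N" and P: "unit_seminorm P" and M: "unit_seminorm M"
  shows "tree_dist N M \<le> tree_dist N P + tree_dist P M"
proof -
  have "diam P \<le> diam (\<lambda>x. max (N x) (P x))" "diam P \<le> diam (\<lambda>x. max (P x) (M x))"
    using unit_ultra[OF P] by (auto intro!: diam_mono)
  thus ?thesis using diam_sup_le_max[OF assms] by (auto simp: tree_dist_def)
qed

subsection \<open>The order rooted at infinity\<close>

definition inf_le :: "('a \<times> 'a \<Rightarrow> real) \<Rightarrow> ('a \<times> 'a \<Rightarrow> real) \<Rightarrow> bool" where
  "inf_le N M \<longleftrightarrow> (\<forall>z. N z * M (1, 0) \<le> M z * N (1, 0))"

lemma inf_leD: "inf_le N M \<Longrightarrow> N z * M (1, 0) \<le> M z * N (1, 0)"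
  unfolding inf_le_def by blast

lemma inf_le_axis_antimono:
  assumes N: "unit_seminorm N" and M: "unit_seminorm M" and inf_le: "inf_le N M"
  shows "M (1, 0) \<le> N (1, 0)"
proof -
  have "N z * M (1, 0) \<le> N (1, 0)" if "max_norm z = 1" for z
  proof -
    have "M z * N (1, 0) \<le> 1 * N (1, 0)"
      using unit_le[OF M, of z] that
      by (intro mult_right_mono ultra_nonneg[OF unit_ultra[OF N]]) simp
    thus ?thesis using inf_leD[OF inf_le, of z] by simp
  qed
  hence "height N * M (1, 0) \<le> N (1, 0)"
    using ultra_nonneg[OF unit_ultra[OF M], of "(1, 0)"]
    by (simp add: height_def max_mult_distrib_right)
  thus ?thesis by (simp add: unit_height[OF N])
qed

lemma unit_le_of_inf_le:
  assumes N: "unit_seminorm N" and M: "unit_seminorm M"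
    and axis: "N (1, 0) \<le> M (1, 0)" and inf_le: "inf_le N M"
  shows "N z \<le> M z"
proof -
  have eq: "N (1, 0) = M (1, 0)" using inf_le_axis_antimono[OF N M inf_le] axis by simp
  show ?thesis
  proof (cases "M (1, 0) = 0")
    case True
    thus ?thesis using eq unit_eq_v_snd[OF N] unit_eq_v_snd[OF M] by simp
  next
    case False
    hence "0 < M (1, 0)" using ultra_nonneg[OF unit_ultra[OF M], of "(1, 0)"] by simp
    thus ?thesis using inf_leD[OF inf_le, of z] by (simp add: eq)
  qed
qed

lemma unit_le_of_max_norm_inf_le:
  assumes N: "unit_seminorm N" and M: "unit_seminorm M"
    and axis: "N (1, 0) \<le> M (1, 0)" and inf_le: "inf_le max_norm M"
  shows "N z \<le> M z"
proof -
  note ultra_N = unit_ultra[OF N] and ultra_M = unit_ultra[OF M]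
  obtain p r where z: "z = (p, r)" by (cases z)
  have "v p * M (1, 0) \<le> max_norm z * M (1, 0)" "v r * M (1, 0) \<le> max_norm z * M (1, 0)"
    by (intro mult_right_mono ultra_nonneg[OF ultra_M]; simp add: z max_norm_def)+
  moreover have "max_norm z * M (1, 0) \<le> M z" using inf_leD[OF inf_le, of z] by simp
  ultimately have p: "v p * M (1, 0) \<le> M z" and r: "v r * M (1, 0) \<le> M z" by simp_all
  have "v r * M (0, 1) \<le> max (M z) (v p * M (1, 0))"
    using ultra_diff[OF ultra_M, of "(p, r)" "(p, 0)"]
    by (simp add: z ultra_axes(1)[OF ultra_M, of p] ultra_axes(2)[OF ultra_M, of r])
  with p r have "v r * height M \<le> M z" by (simp add: height_def max_mult_distrib_left)
  moreover have "N z \<le> max (v p * N (1, 0)) (v r * N (0, 1))"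
    using ultra_add[OF ultra_N, of "(p, 0)" "(0, r)"]
    by (simp add: z ultra_axes(1)[OF ultra_N, of p] ultra_axes(2)[OF ultra_N, of r])
  moreover have "v p * N (1, 0) \<le> v p * M (1, 0)" "v r * N (0, 1) \<le> v r * 1"
    using axis unit_le[OF N, of "(0, 1)"] by (intro mult_left_mono; simp)+
  ultimately show ?thesis using p unit_height[OF M] by auto
qed

definition inf_join :: "('a \<times> 'a \<Rightarrow> real) \<Rightarrow> 'a \<times> 'a \<Rightarrow> real" where
  "inf_join N = thicken N (N (1, 0))"

lemma unit_inf_join:
  assumes N: "unit_seminorm N"
  shows "unit_seminorm (inf_join N)"
  unfolding inf_join_def using ultra_nonneg[OF unit_ultra[OF N]] unit_le[OF N, of "(1, 0)"]
  by (intro unit_thicken[OF N]) simp_all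

lemma inf_join_axis: "inf_join N (1, 0) = N (1, 0)"
  by (simp add: inf_join_def thicken_def)

lemma inf_join_upper:
  assumes "ultra_seminorm N"
  shows "inf_le N (inf_join N)" "inf_le max_norm (inf_join N)"
proof -
  have "N z \<le> inf_join N z" "max_norm z * N (1, 0) \<le> inf_join N z" for z
    by (simp_all add: inf_join_def thicken_def mult.commute)
  thus "inf_le N (inf_join N)" "inf_le max_norm (inf_join N)"
    using ultra_nonneg[OF assms, of "(1, 0)"]
    by (simp_all add: inf_le_def inf_join_axis mult_right_mono)
qed

lemma inf_join_least:
  assumes N: "ultra_seminorm N" and "inf_le N M" "inf_le max_norm M"
  shows "inf_le (inf_join N) M"
  unfolding inf_le_def
proof
  fix z
  define t where "t = N (1, 0)"
  have "N z * M (1, 0) \<le> M z * t" using inf_leD[OF assms(2), of z] by (simp add: t_def)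
  moreover have "t * (max_norm z * M (1, 0)) \<le> t * M z"
    using inf_leD[OF assms(3), of z] ultra_nonneg[OF N]
    by (intro mult_left_mono) (simp_all add: t_def)
  ultimately have "max (N z) (t * max_norm z) * M (1, 0) \<le> M z * t" by (simp add: max_def mult_ac)
  thus "inf_join N z * M (1, 0) \<le> M z * inf_join N (1, 0)"
    by (simp only: inf_join_axis) (simp only: inf_join_def thicken_def t_def)
qed

text \<open>By \<open>unit_eq_thicken\<close> a seminorm \<open>M\<close> above \<open>N\<close> is \<open>thicken N d\<close>; it lies on the branch of
  \<open>N\<close> if \<open>d \<le> N (1, 0)\<close>, and on the branch of the Gauss point otherwise.\<close>

lemma inf_le_of_unit_le:
  assumes N: "unit_seminorm N" and M: "unit_seminorm M" and below: "\<And>z. N z \<le> M z"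
  shows "inf_le N M \<or> inf_le max_norm M" and "inf_le M (inf_join N)"
proof -
  define d t m where "d = diam M" and "t = N (1, 0)" and "m = M (1, 0)"
  have M_eq: "M = thicken N d" unfolding d_def by (rule unit_eq_thicken[OF N M below])
  hence m: "m = max t d" by (simp add: m_def t_def thicken_def)
  have nonneg: "0 \<le> t" "0 \<le> N z" for z using ultra_nonneg[OF unit_ultra[OF N]]
    by (simp_all add: t_def)
  show "inf_le N M \<or> inf_le max_norm M"
  proof (cases "d \<le> t")
    case True
    hence "m = t" by (simp add: m)
    hence "inf_le N M" using below nonneg
      by (auto simp: inf_le_def m_def t_def intro: mult_right_mono)
    thus ?thesis ..
  next
    case False
    hence "m = d" by (simp add: m)
    moreover have "max_norm z * d \<le> M z" for z by (simp add: M_eq thicken_def mult.commute)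
    ultimately have "inf_le max_norm M" by (simp add: inf_le_def m_def)
    thus ?thesis ..
  qed
  have "M z * t \<le> inf_join N z * m" for z
  proof -
    have "max (N z * t) (d * (max_norm z * t)) \<le> max (N z * m) (m * (max_norm z * t))"
      using nonneg by (intro max.mono mult_left_mono mult_right_mono) (simp_all add: m)
    moreover have "0 \<le> m" using nonneg by (simp add: m le_max_iff_disj)
    ultimately have "max (N z) (d * max_norm z) * t \<le> max (N z) (t * max_norm z) * m"
      using nonneg by (simp add: max_mult_distrib_left mult_ac)
    thus ?thesis unfolding M_eq inf_join_def thicken_def t_def .
  qed
  thus "inf_le M (inf_join N)" by (simp add: inf_le_def inf_join_axis t_def m_def)
qed

lemma between_iff_unit_le:
  assumes N: "unit_seminorm N" and M: "unit_seminorm M"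
  shows "(inf_le N M \<or> inf_le max_norm M) \<and> inf_le M (inf_join N) \<longleftrightarrow> (\<forall>z. N z \<le> M z)"
proof
  assume between: "(inf_le N M \<or> inf_le max_norm M) \<and> inf_le M (inf_join N)"
  hence "N (1, 0) \<le> M (1, 0)"
    using inf_le_axis_antimono[OF M unit_inf_join[OF N]] by (simp add: inf_join_axis)
  thus "\<forall>z. N z \<le> M z"
    using between unit_le_of_inf_le[OF N M] unit_le_of_max_norm_inf_le[OF N M] by blast
next
  assume "\<forall>z. N z \<le> M z"
  hence "\<And>z. N z \<le> M z" by blast
  thus "(inf_le N M \<or> inf_le max_norm M) \<and> inf_le M (inf_join N)"
    using inf_le_of_unit_le[OF N M] by blast
qed

end

section \<open>Pullback along the adjugate matrix\<close>

locale moebius = nonarch_field v for v :: "'a::field \<Rightarrow> real" +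
  fixes a b c e :: 'a
  assumes det: "a * e - b * c \<noteq> 0"
begin

definition vdet :: real where
  "vdet = v (a * e - b * c)"

definition vmax :: real where
  "vmax = max (max (v a) (v b)) (max (v c) (v e))"

definition mat :: "'a \<times> 'a \<Rightarrow> 'a \<times> 'a" where
  "mat x = (a * fst x + b * snd x, c * fst x + e * snd x)"

definition adj :: "'a \<times> 'a \<Rightarrow> 'a \<times> 'a" where
  "adj x = (e * fst x - b * snd x, a * snd x - c * fst x)"

definition factor :: "('a \<times> 'a \<Rightarrow> real) \<Rightarrow> real" where
  "factor N = height (N \<circ> adj)"

definition act :: "('a \<times> 'a \<Rightarrow> real) \<Rightarrow> 'a \<times> 'a \<Rightarrow> real" where
  "act N = normed (N \<circ> adj)"

lemma moebius_inverse: "moebius v e (- b) (- c) a"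
  using det by unfold_locales (simp add: mult.commute)

lemma vdet_pos: "0 < vdet"
  using det by (simp add: vdet_def)

lemma entries_le_vmax: "v a \<le> vmax" "v b \<le> vmax" "v c \<le> vmax" "v e \<le> vmax"
  by (auto simp: vmax_def)

lemma vmax_pos: "0 < vmax"
proof -
  have "a \<noteq> 0 \<or> b \<noteq> 0" using det by auto
  hence "0 < v a \<or> 0 < v b" by simp
  thus ?thesis using entries_le_vmax by linarith
qed

lemma adj_scale: "adj (k \<odot> x) = k \<odot> adj x"
  and adj_add: "adj (x + y) = adj x + adj y"
  by (simp_all add: adj_def prod_eq_iff algebra_simps)

lemma mat_adj: "mat (adj x) = (a * e - b * c) \<odot> x"
  and adj_mat: "adj (mat x) = (a * e - b * c) \<odot> x"
  by (simp_all add: mat_def adj_def prod_eq_iff algebra_simps)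

lemma wedge_adj: "wedge (adj x) (adj y) = (a * e - b * c) * wedge x y"
  and wedge_mat: "wedge (mat x) (mat y) = (a * e - b * c) * wedge x y"
  and wedge_mat_left: "wedge (mat x) y = wedge x (adj y)"
  by (simp_all add: wedge_def mat_def adj_def algebra_simps)

lemma ultra_comp_adj: "ultra_seminorm N \<Longrightarrow> ultra_seminorm (N \<circ> adj)"
  by (rule ultra_comp) (simp_all add: adj_scale adj_add)

lemma comp_adj_mat: "ultra_seminorm N \<Longrightarrow> N \<circ> adj \<circ> mat = (\<lambda>x. vdet * N x)"
  by (simp add: fun_eq_iff adj_mat ultra_scale vdet_def)

lemma max_norm_mat_le: "max_norm (mat x) \<le> vmax * max_norm x"
proof -
  have "v (p * fst x + r * snd x) \<le> vmax * max_norm x" if "v p \<le> vmax" "v r \<le> vmax" for p r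
  proof -
    have "v (p * fst x) \<le> vmax * max_norm x" "v (r * snd x) \<le> vmax * max_norm x"
      unfolding v_mult using that vmax_pos by (intro mult_mono; simp add: max_norm_def)+
    thus ?thesis using v_add[of "p * fst x" "r * snd x"] by simp
  qed
  thus ?thesis unfolding max_norm_def[of "mat x"] unfolding mat_def by (simp add: entries_le_vmax)
qed

lemma factor_max_norm: "factor max_norm = vmax"
  by (simp add: factor_def height_def adj_def max_norm_def vmax_def max.commute max.left_commute)

lemma vdet_le_vmax_factor:
  assumes N: "unit_seminorm N"
  shows "vdet \<le> vmax * factor N"
proof -
  note ultra = unit_ultra[OF N]
  have "vdet * N x \<le> vmax * factor N" if "max_norm x = 1" for x
  proof -
    have "vdet * N x = (N \<circ> adj) (mat x)" using comp_adj_mat[OF ultra] by (metis comp_apply)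
    also have "\<dots> \<le> factor N * max_norm (mat x)"
      unfolding factor_def by (rule ultra_le_height[OF ultra_comp_adj[OF ultra]])
    also have "\<dots> \<le> factor N * vmax"
      using max_norm_mat_le[of x] that height_nonneg[OF ultra_comp_adj[OF ultra]]
      by (intro mult_left_mono) (simp_all add: factor_def)
    finally show ?thesis by (simp add: mult.commute)
  qed
  hence "vdet * height N \<le> vmax * factor N"
    using vdet_pos by (simp add: height_def max_mult_distrib_left)
  thus ?thesis by (simp add: unit_height[OF N])
qed

lemma factor_pos: "unit_seminorm N \<Longrightarrow> 0 < factor N"
  using vdet_le_vmax_factor[of N] vdet_pos vmax_pos
  by (metis order_less_le_trans zero_less_mult_pos)

lemma unit_act: "unit_seminorm N \<Longrightarrow> unit_seminorm (act N)"
  unfolding act_def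
  by (intro unit_normed ultra_comp_adj unit_ultra) (auto simp: factor_pos simp flip: factor_def)

lemma covol_comp_adj:
  assumes N: "ultra_seminorm N"
  shows "covol (N \<circ> adj) = vdet * covol N"
proof (rule antisym)
  show "vdet * covol N \<le> covol (N \<circ> adj)"
    unfolding vdet_def by (rule covol_comp_ge[OF N wedge_adj])
  have "vdet * covol (N \<circ> adj) \<le> covol (N \<circ> adj \<circ> mat)"
    unfolding vdet_def by (rule covol_comp_ge[OF ultra_comp_adj[OF N] wedge_mat])
  also have "\<dots> = vdet * (vdet * covol N)"
    unfolding comp_adj_mat[OF N] covol_mult[OF N vdet_pos] by (simp add: power2_eq_square)
  finally show "covol (N \<circ> adj) \<le> vdet * covol N" using vdet_pos by simp
qed

lemma diam_act:
  assumes N: "unit_seminorm N"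
  shows "diam (act N) = vdet * diam N / (factor N)\<^sup>2"
  using factor_pos[OF N] covol_eq_diam_height[OF unit_ultra[OF N]]
  by (simp add: act_def factor_def diam_normed ultra_comp_adj covol_comp_adj unit_ultra[OF N]
      unit_height[OF N])

lemma act_inverse:
  assumes N: "unit_seminorm N"
  shows "moebius.act e (- b) (- c) a (act N) = N"
proof -
  have adj: "moebius.adj e (- b) (- c) a = mat"
    by (simp add: fun_eq_iff mat_def moebius.adj_def[OF moebius_inverse])
  have "moebius.act e (- b) (- c) a (act N) = normed (N \<circ> adj \<circ> mat)"
    using factor_pos[OF N] unfolding moebius.act_def[OF moebius_inverse] adj act_def factor_def
    by (rule normed_normed_comp)
  also have "\<dots> = N"
    unfolding comp_adj_mat[OF unit_ultra[OF N]] normed_mult[OF vdet_pos] by (rule normed_unit[OF N])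
  finally show ?thesis .
qed

subsection \<open>The Lipschitz bound\<close>

lemma factor_thicken: "0 \<le> t \<Longrightarrow> factor (thicken N t) = max (factor N) (t * vmax)"
  unfolding factor_max_norm[symmetric] factor_def height_def thicken_def comp_apply
  by (simp add: max_mult_distrib_left max.assoc max.left_commute)

lemma diam_mult_vmax_le: "ultra_seminorm N \<Longrightarrow> diam N * vmax \<le> factor N"
  using diam_mult_le[of N "adj (1, 0)"] diam_mult_le[of N "adj (0, 1)"] diam_nonneg[of N]
  unfolding factor_max_norm[symmetric] factor_def height_def comp_apply
  by (auto simp: max_mult_distrib_left intro: max.coboundedI1 max.coboundedI2)

text \<open>The image of the path from \<open>N\<close> up to \<open>M\<close> turns back at the join of its endpoints, which is the
  image of the point of that path with diameter \<open>diam M * factor N / factor M\<close>.\<close>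

lemma sup_act_comparable:
  assumes N: "unit_seminorm N" and M: "unit_seminorm M" and below: "\<And>x. N x \<le> M x"
  defines "t \<equiv> diam M * factor N / factor M"
  shows "(\<lambda>x. max (act N x) (act M x)) = act (thicken N t)" and "factor (thicken N t) = factor N"
proof -
  note pos = factor_pos[OF N] factor_pos[OF M]
  have M_eq: "M = thicken N (diam M)" by (rule unit_eq_thicken[OF N M below])
  have diam_M: "0 \<le> diam M" by (rule diam_nonneg[OF unit_ultra[OF M]])
  have t: "0 \<le> t" using diam_M pos by (simp add: t_def)
  have "factor M = max (factor N) (diam M * vmax)"
    using factor_thicken[OF diam_M, of N] M_eq by simp
  hence factors_le: "factor N \<le> factor M" "diam M * vmax \<le> factor M" by simp_all
  have "t * vmax \<le> factor N"
    using mult_right_mono[OF factors_le(2), of "factor N"] pos by (simp add: t_def field_simps)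
  thus factor_t: "factor (thicken N t) = factor N" by (simp add: factor_thicken[OF t])
  show "(\<lambda>x. max (act N x) (act M x)) = act (thicken N t)"
  proof
    fix x
    define n m where "n = N (adj x)" and "m = max_norm (adj x)"
    have n: "n / factor M \<le> n / factor N"
      using factors_le(1) pos ultra_nonneg[OF unit_ultra[OF N], of "adj x"]
      by (intro divide_left_mono) (auto simp: n_def)
    have "M (adj x) = max n (diam M * m)" unfolding n_def m_def
      by (subst M_eq) (simp add: thicken_def)
    hence "act M x = max n (diam M * m) / factor M"
      by (simp add: act_def normed_def factor_def[symmetric])
    also have "\<dots> = max (n / factor M) (t * m / factor N)"
      using pos by (simp add: max_divide_distrib_right t_def)
    finally have "max (act N x) (act M x) = max (n / factor N) (t * m / factor N)"
      using n by (auto simp: act_def normed_def factor_def[symmetric] n_def)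
    also have "\<dots> = max n (t * m) / factor N" using pos by (simp add: max_divide_distrib_right)
    also have "\<dots> = act (thicken N t) x"
      using factor_t by (simp add: act_def normed_def factor_def[symmetric] thicken_def n_def m_def)
    finally show "max (act N x) (act M x) = act (thicken N t) x" .
  qed
qed

lemma diam_sup_act_comparable:
  assumes N: "unit_seminorm N" and M: "unit_seminorm M" and below: "\<And>x. N x \<le> M x"
  shows "diam (\<lambda>x. max (act N x) (act M x)) = vdet * diam M / (factor N * factor M)"
proof -
  define s t g h where "s = diam N" and "t = diam M" and "g = factor N" and "h = factor M"
  define t' where "t' = t * g / h"
  have gh: "0 < g" "0 < h" using factor_pos N M by (simp_all add: g_def h_def)
  have st: "0 \<le> s" "s \<le> t"
    using diam_nonneg diam_mono below unit_ultra[OF N] by (simp_all add: s_def t_def)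
  have h_eq: "h = max g (t * vmax)"
    using factor_thicken[of t N] st unit_eq_thicken[OF N M below] by (simp add: g_def h_def t_def)
  have "s * vmax \<le> g" using diam_mult_vmax_le[OF unit_ultra[OF N]] by (simp add: s_def g_def)
  hence "s * h \<le> t * g"
    unfolding h_eq using mult_mono[OF st(2), of g g] mult_left_mono[of "s * vmax" g t] st gh
    by (auto simp: max_def mult_ac)
  hence t': "s \<le> t'" using gh by (simp add: t'_def pos_le_divide_eq)
  have "t' \<le> t" unfolding t'_def using h_eq st gh by (simp add: pos_divide_le_eq mult_left_mono)
  hence "t' \<le> 1" using diam_unit_le_1[OF M] by (simp add: t_def)
  hence unit: "unit_seminorm (thicken N t')" using t' st by (intro unit_thicken[OF N]) simp_all
  note join = sup_act_comparable[OF N M below, folded t_def g_def h_def, folded t'_def]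
  have "diam (\<lambda>x. max (act N x) (act M x)) = vdet * max s t' / g\<^sup>2"
    unfolding join(1) diam_act[OF unit] join(2) using t' st
    by (simp add: diam_thicken[OF unit_ultra[OF N]] s_def)
  also have "\<dots> = vdet * t / (g * h)"
    using t' gh by (simp add: max_absorb2 t'_def power2_eq_square)
  finally show ?thesis by (simp add: t_def g_def h_def)
qed

lemma act_lipschitz_comparable:
  assumes N: "unit_seminorm N" and M: "unit_seminorm M" and below: "\<And>x. N x \<le> M x"
  shows "tree_dist (act N) (act M) \<le> vmax\<^sup>2 / vdet * (diam M - diam N)"
proof -
  define s t g h where "s = diam N" and "t = diam M" and "g = factor N" and "h = factor M"
  have gh: "0 < g" "0 < h" using factor_pos N M by (simp_all add: g_def h_def)
  have st: "0 \<le> s" "s \<le> t"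
    using diam_nonneg diam_mono below unit_ultra[OF N] by (simp_all add: s_def t_def)
  have "tree_dist (act N) (act M) = vdet * (2 * (t / (g * h)) - s / g\<^sup>2 - t / h\<^sup>2)"
    unfolding tree_dist_def diam_sup_act_comparable[OF N M below] diam_act[OF N] diam_act[OF M]
    by (simp add: s_def t_def g_def h_def algebra_simps)
  also have "2 * (t / (g * h)) - s / g\<^sup>2 - t / h\<^sup>2 = (t - s) / g\<^sup>2 - t * (1 / g - 1 / h)\<^sup>2"
    using gh by (simp add: field_simps power2_eq_square)
  also have "vdet * \<dots> \<le> vdet * ((t - s) / g\<^sup>2)"
    using st vdet_pos by (intro mult_left_mono) auto
  also have "\<dots> = vdet / g\<^sup>2 * (t - s)" by simp
  also have "\<dots> \<le> vmax\<^sup>2 / vdet * (t - s)"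
  proof (rule mult_right_mono)
    have "vdet\<^sup>2 \<le> (vmax * g)\<^sup>2"
      using vdet_le_vmax_factor[OF N] vdet_pos by (intro power_mono) (auto simp: g_def)
    thus "vdet / g\<^sup>2 \<le> vmax\<^sup>2 / vdet" using gh vdet_pos by (simp add: field_simps power2_eq_square)
  qed (use st in simp)
  finally show ?thesis by (simp add: s_def t_def)
qed

lemma act_lipschitz:
  assumes N: "unit_seminorm N" and M: "unit_seminorm M"
  shows "tree_dist (act N) (act M) \<le> vmax\<^sup>2 / vdet * tree_dist N M"
proof -
  define J where "J = (\<lambda>x. max (N x) (M x))"
  have J: "unit_seminorm J" unfolding J_def by (rule unit_sup[OF N M])
  have "tree_dist (act N) (act M) \<le> tree_dist (act N) (act J) + tree_dist (act J) (act M)"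
    by (intro tree_dist_triangle unit_act N M J)
  also have "\<dots> \<le> vmax\<^sup>2 / vdet * (diam J - diam N) + vmax\<^sup>2 / vdet * (diam J - diam M)"
    unfolding tree_dist_commute[of "act J"] using N M J
    by (intro add_mono act_lipschitz_comparable) (auto simp: J_def)
  also have "\<dots> = vmax\<^sup>2 / vdet * tree_dist N M"
    unfolding tree_dist_def J_def[symmetric] distrib_left[symmetric] by simp
  finally show ?thesis .
qed

end

section \<open>Multiplicative seminorms on polynomials\<close>

lemma poly_eqI_cofinite:
  fixes p q :: "'a::idom poly"
  assumes "infinite (UNIV :: 'a set)" "finite {x. poly p x \<noteq> poly q x}"
  shows "p = q"
proof (rule ccontr)
  assume "p \<noteq> q"
  hence "finite {x. poly (p - q) x = 0}" by (intro poly_roots_finite) simp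
  hence "finite ({x. poly p x = poly q x} \<union> {x. poly p x \<noteq> poly q x})"
    using assms(2) by simp
  moreover have "{x. poly p x = poly q x} \<union> {x. poly p x \<noteq> poly q x} = UNIV" by blast
  ultimately show False using assms(1) by simp
qed

definition linear_form :: "'a::comm_ring_1 \<times> 'a \<Rightarrow> 'a poly" where
  "linear_form x = [:- fst x, snd x:]"

lemma linear_form_scale: "linear_form (k \<odot> x) = smult k (linear_form x)"
  and linear_form_add: "linear_form (x + y) = linear_form x + linear_form y"
  by (simp_all add: linear_form_def)

context nonarch_field
begin

lemma seminorm_nonneg: "berk_seminorm v s \<Longrightarrow> 0 \<le> s f"
  and seminorm_const: "berk_seminorm v s \<Longrightarrow> s [:c:] = v c"
  and seminorm_mult: "berk_seminorm v s \<Longrightarrow> s (f * g) = s f * s g"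
  and seminorm_triangle: "berk_seminorm v s \<Longrightarrow> s (f + g) \<le> s f + s g"
  by (auto simp: berk_seminorm_def)

lemma seminorm_0: "berk_seminorm v s \<Longrightarrow> s 0 = 0"
  using seminorm_const[of s 0] by simp

lemma seminorm_1: "berk_seminorm v s \<Longrightarrow> s 1 = 1"
  using seminorm_const[of s 1] by (simp add: one_pCons)

lemma seminorm_power: "berk_seminorm v s \<Longrightarrow> s (f ^ n) = s f ^ n"
  by (induction n) (auto simp: seminorm_1 seminorm_mult)

lemma seminorm_smult: "berk_seminorm v s \<Longrightarrow> s (smult c f) = v c * s f"
  using seminorm_mult[of s "[:c:]" f] by (simp add: seminorm_const)

lemma seminorm_sum: "berk_seminorm v s \<Longrightarrow> s (sum f I) \<le> (\<Sum>i\<in>I. s (f i))"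
proof (induction I rule: infinite_finite_induct)
  case (insert x F)
  thus ?case using seminorm_triangle[of s "f x" "sum f F"] by simp
qed (auto simp: seminorm_0)

lemma seminorm_ultra:
  assumes s: "berk_seminorm v s"
  shows "s (f + g) \<le> max (s f) (s g)"
proof (rule le_of_power_le_linear)
  let ?M = "max (s f) (s g)"
  show "0 \<le> ?M" using seminorm_nonneg[OF s] by (simp add: le_max_iff_disj)
  fix n
  have "s (f + g) ^ n = s (\<Sum>k\<le>n. of_nat (n choose k) * f ^ k * g ^ (n - k))"
    by (simp add: seminorm_power[OF s, symmetric] binomial_ring)
  also have "\<dots> \<le> (\<Sum>k\<le>n. s (of_nat (n choose k) * f ^ k * g ^ (n - k)))"
    by (rule seminorm_sum[OF s])
  also have "\<dots> \<le> (\<Sum>k\<le>n. ?M ^ n)"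
  proof (rule sum_mono)
    fix k assume k: "k \<in> {..n}"
    have "s (of_nat (n choose k) * f ^ k * g ^ (n - k))
        = v (of_nat (n choose k)) * (s f ^ k * s g ^ (n - k))"
      by (simp add: seminorm_mult[OF s] seminorm_power[OF s] of_nat_poly seminorm_smult[OF s])
    also have "\<dots> \<le> 1 * (?M ^ k * ?M ^ (n - k))"
      by (intro mult_mono v_of_nat power_mono) (auto simp: seminorm_nonneg[OF s] le_max_iff_disj)
    also have "\<dots> = ?M ^ n" using k by (simp flip: power_add)
    finally show "s (of_nat (n choose k) * f ^ k * g ^ (n - k)) \<le> ?M ^ n" .
  qed
  also have "\<dots> = (real n + 1) * ?M ^ n" by simp
  finally show "s (f + g) ^ n \<le> (real n + 1) * ?M ^ n" .
qed

lemma ultra_linear_form: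
  assumes s: "berk_seminorm v s"
  shows "ultra_seminorm (s \<circ> linear_form)"
  using seminorm_smult[OF s] seminorm_ultra[OF s]
  by (simp add: ultra_seminorm_def linear_form_scale linear_form_add)

lemma seminorm_linear_form_axis:
  assumes "berk_seminorm v s"
  shows "s (linear_form (1, 0)) = 1"
  using seminorm_const[OF assms, of "-1"] by (simp add: linear_form_def)

lemma height_linear_form:
  assumes "berk_seminorm v s"
  shows "height (s \<circ> linear_form) = max 1 (s [:0, 1:])"
  using seminorm_linear_form_axis[OF assms] by (simp add: height_def linear_form_def[of "(0, 1)"])

lemma height_linear_form_pos: "berk_seminorm v s \<Longrightarrow> 0 < height (s \<circ> linear_form)"
  by (simp add: height_linear_form less_max_iff_disj)

lemma seminorm_pcompose:
  assumes s: "berk_seminorm v s"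
  shows "berk_seminorm v (\<lambda>f. s (f \<circ>\<^sub>p q))"
  by (simp add: berk_seminorm_def pcompose_add pcompose_mult seminorm_nonneg[OF s]
      seminorm_const[OF s] seminorm_mult[OF s] seminorm_triangle[OF s])

lemma seminorm_eval: "berk_seminorm v (\<lambda>f. v (poly f x))"
proof -
  have "v (p + q) \<le> v p + v q" for p q
    using v_add[of p q] v_nonneg[of p] v_nonneg[of q] by linarith
  thus ?thesis by (simp add: berk_seminorm_def v_mult)
qed

subsection \<open>Disc seminorms\<close>

definition gauss :: "real \<Rightarrow> 'a poly \<Rightarrow> real" where
  "gauss R f = Max ((\<lambda>i. v (coeff f i) * R ^ i) ` {..degree f})"

lemma gauss_ge: "0 \<le> R \<Longrightarrow> v (coeff f i) * R ^ i \<le> gauss R f"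
proof (cases "i \<le> degree f")
  case False
  assume "0 \<le> R"
  hence "0 \<le> v (coeff f 0) * R ^ 0" by simp
  also have "\<dots> \<le> gauss R f" unfolding gauss_def by (intro Max_ge) (auto intro!: image_eqI[of _ _ 0])
  finally show ?thesis using False by (simp add: coeff_eq_0)
qed (auto simp: gauss_def)

lemma gauss_nonneg: "0 \<le> R \<Longrightarrow> 0 \<le> gauss R f"
  using gauss_ge[of R f 0] order_trans[of 0 "v (coeff f 0) * R ^ 0"] by simp

lemma gauss_leI: "(\<And>i. v (coeff f i) * R ^ i \<le> B) \<Longrightarrow> gauss R f \<le> B"
  unfolding gauss_def by (subst Max_le_iff) auto

lemma gauss_attained: "\<exists>i. gauss R f = v (coeff f i) * R ^ i"
proof -
  have "gauss R f \<in> (\<lambda>i. v (coeff f i) * R ^ i) ` {..degree f}"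
    unfolding gauss_def by (intro Max_in) auto
  thus ?thesis by auto
qed

lemma gauss_add_le:
  assumes "0 \<le> R"
  shows "gauss R (f + g) \<le> max (gauss R f) (gauss R g)"
proof (rule gauss_leI)
  fix i
  have "v (coeff (f + g) i) * R ^ i \<le> max (v (coeff f i)) (v (coeff g i)) * R ^ i"
    using assms by (intro mult_right_mono) (auto simp: v_add)
  also have "\<dots> \<le> max (gauss R f) (gauss R g)"
    using gauss_ge[OF assms, of f i] gauss_ge[OF assms, of g i] by (auto simp: max_def)
  finally show "v (coeff (f + g) i) * R ^ i \<le> max (gauss R f) (gauss R g)" .
qed

lemma gauss_mult_le:
  assumes R: "0 \<le> R"
  shows "gauss R (f * g) \<le> gauss R f * gauss R g"
proof (rule gauss_leI)
  fix n
  have nonneg: "0 \<le> gauss R f * gauss R g" by (simp add: gauss_nonneg R)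
  show "v (coeff (f * g) n) * R ^ n \<le> gauss R f * gauss R g"
  proof (cases "R ^ n = 0")
    case False
    hence R_pow_pos: "0 < R ^ n" using R by (metis zero_le_power order_less_le)
    have "v (coeff f k * coeff g (n - k)) \<le> gauss R f * gauss R g / R ^ n" if "k \<in> {..n}" for k
    proof -
      have "v (coeff f k * coeff g (n - k)) * R ^ n
          = (v (coeff f k) * R ^ k) * (v (coeff g (n - k)) * R ^ (n - k))"
        using that by (simp add: v_mult power_add[symmetric] mult_ac)
      also have "\<dots> \<le> gauss R f * gauss R g"
        by (intro mult_mono gauss_ge gauss_nonneg R) (use R in auto)
      finally show ?thesis using R_pow_pos by (simp add: field_simps)
    qed
    hence "v (coeff (f * g) n) \<le> gauss R f * gauss R g / R ^ n"
      unfolding coeff_mult using R_pow_pos nonneg by (intro v_sum_le) auto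
    thus ?thesis using R_pow_pos by (simp add: field_simps)
  qed (use nonneg in \<open>simp only: mult_zero_right\<close>)
qed

lemma gauss_least_index:
  assumes "0 \<le> R"
  obtains i where "gauss R f = v (coeff f i) * R ^ i"
    "\<And>k. k < i \<Longrightarrow> v (coeff f k) * R ^ k < gauss R f"
proof -
  obtain i where "gauss R f = v (coeff f i) * R ^ i"
    "\<And>k. k < i \<Longrightarrow> gauss R f \<noteq> v (coeff f k) * R ^ k"
    using gauss_attained[of R f] exists_least_iff[of "\<lambda>i. gauss R f = v (coeff f i) * R ^ i"]
    by blast
  with gauss_ge[OF assms, of f] show thesis by (intro that[of i]) (metis order_less_le)+
qed

text \<open>At the sum of the least indices where the maxima are attained, a single product dominates.\<close>

lemma gauss_mult_ge:
  assumes R: "0 \<le> R"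
  shows "gauss R f * gauss R g \<le> gauss R (f * g)"
proof (cases "gauss R f * gauss R g = 0")
  case False
  define F G where "F = gauss R f" and "G = gauss R g"
  have FG: "0 < F" "0 < G"
    using False gauss_nonneg[OF R, of f] gauss_nonneg[OF R, of g] by (auto simp: F_def G_def)
  obtain i where i: "F = v (coeff f i) * R ^ i" and less_i: "\<And>k. k < i \<Longrightarrow> v (coeff f k) * R ^ k < F"
    unfolding F_def using gauss_least_index[OF R] by blast
  obtain j where j: "G = v (coeff g j) * R ^ j" and less_j: "\<And>k. k < j \<Longrightarrow> v (coeff g k) * R ^ k < G"
    unfolding G_def using gauss_least_index[OF R] by blast
  define n where "n = i + j"
  define summand where "summand k = coeff f k * coeff g (n - k)" for k
  have R_pow_pos: "0 < R ^ n" using FG i j R by (auto simp: n_def power_add zero_less_mult_iff)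
  have weight:
    "v (summand k) * R ^ n = (v (coeff f k) * R ^ k) * (v (coeff g (n - k)) * R ^ (n - k))"
    if "k \<le> n" for k
    using that by (simp add: summand_def v_mult mult_ac flip: power_add)
  have lead: "v (summand i) * R ^ n = F * G" unfolding i j using weight[of i] by (simp add: n_def)
  have "v (summand k) < v (summand i)" if k: "k \<in> {..n} - {i}" for k
  proof -
    have weights_le: "v (coeff f k) * R ^ k \<le> F" "v (coeff g (n - k)) * R ^ (n - k) \<le> G"
      unfolding F_def G_def by (rule gauss_ge[OF R])+
    have "k < i \<or> n - k < j" using k by (auto simp: n_def)
    hence "v (coeff f k) * R ^ k < F \<or> v (coeff g (n - k)) * R ^ (n - k) < G"
      using less_i less_j by blast
    hence "(v (coeff f k) * R ^ k) * (v (coeff g (n - k)) * R ^ (n - k)) < F * G"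
      using weights_le FG R by (intro mult_less_mono_disj) auto
    thus ?thesis using weight[of k] lead k R_pow_pos
      by (metis DiffD1 atMost_iff mult_less_cancel_right_pos)
  qed
  moreover have "summand i \<noteq> 0" using lead FG R_pow_pos by auto
  ultimately have "v (coeff (f * g) n) = v (summand i)"
    unfolding coeff_mult summand_def[symmetric] by (intro v_sum_eq_dominant) (auto simp: n_def)
  thus ?thesis using gauss_ge[OF R, of "f * g" n] lead by (simp add: F_def G_def)
qed (auto simp: gauss_nonneg[OF R])

lemma gauss_seminorm:
  assumes R: "0 \<le> R"
  shows "berk_seminorm v (gauss R)"
  unfolding berk_seminorm_def
proof (intro conjI allI)
  fix f g
  show "0 \<le> gauss R f" by (rule gauss_nonneg[OF R])
  show "gauss R (f * g) = gauss R f * gauss R g" by (intro antisym gauss_mult_le gauss_mult_ge R)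
  show "gauss R (f + g) \<le> gauss R f + gauss R g"
    using gauss_add_le[OF R, of f g] gauss_nonneg[OF R, of f] gauss_nonneg[OF R, of g] by linarith
qed (simp add: gauss_def)

definition disc :: "'a \<Rightarrow> real \<Rightarrow> 'a poly \<Rightarrow> real" where
  "disc b R f = gauss R (f \<circ>\<^sub>p [:b, 1:])"

lemma disc_seminorm: "0 \<le> R \<Longrightarrow> berk_seminorm v (disc b R)"
  unfolding disc_def[abs_def] by (intro seminorm_pcompose gauss_seminorm)

lemma disc_linear: "disc b R [:- a, 1:] = max (v (b - a)) R"
  by (simp add: disc_def pcompose_pCons gauss_def atMost_Suc max.commute)

end

locale alg_closed_nonarch_field = nonarch_field v for v :: "'a::field \<Rightarrow> real" +
  assumes nontrivial: "nontrivial_abs v"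
    and alg_closed: "alg_closed_field TYPE('a)"
begin

lemma ex_v_less_1: "\<exists>t. t \<noteq> 0 \<and> v t < 1"
proof -
  obtain x where x: "x \<noteq> 0" "v x \<noteq> 1"
    using nontrivial by (auto simp: nontrivial_abs_def)
  show ?thesis
  proof (cases "v x < 1")
    case False
    hence "v (1 / x) < 1" using x by (simp add: v_divide)
    thus ?thesis using x by (intro exI[of _ "1 / x"]) simp
  qed (use x in auto)
qed

lemma infinite_field: "infinite (UNIV :: 'a set)"
proof
  assume fin: "finite (UNIV :: 'a set)"
  obtain t where t: "t \<noteq> 0" "v t < 1" using ex_v_less_1 by blast
  have "inj (\<lambda>n::nat. t ^ n)"
  proof (rule injI)
    fix m n assume "t ^ m = t ^ n"
    hence "v t ^ m = v t ^ n" by (metis v_power)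
    thus "m = n" using t by (simp add: power_inject_exp')
  qed
  thus False using fin by (meson finite_subset subset_UNIV range_inj_infinite)
qed

lemma ex_root: "1 \<le> degree (p :: 'a poly) \<Longrightarrow> \<exists>x. poly p x = 0"
  using alg_closed by (auto simp: alg_closed_field_def)

lemma seminorm_le_of_linear_factors:
  assumes s: "berk_seminorm v s" and t: "berk_seminorm v t"
    and linear_le: "f \<noteq> 0 \<Longrightarrow> (\<And>a. poly f a = 0 \<Longrightarrow> s [:-a, 1:] \<le> t [:-a, 1:])"
  shows "s f \<le> t f"
  using linear_le
proof (induction "degree f" arbitrary: f)
  case 0
  then obtain c where "f = [:c:]" by (metis degree_eq_zeroE)
  thus ?case by (simp add: seminorm_const[OF s] seminorm_const[OF t])
next
  case (Suc n)
  obtain a where a: "poly f a = 0" using ex_root[of f] Suc.hyps(2) by auto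
  then obtain g where g: "f = [:-a, 1:] * g" by (metis poly_eq_0_iff_dvd dvdE)
  have f_nonzero: "f \<noteq> 0" using Suc.hyps(2) by auto
  hence "g \<noteq> 0" using g by auto
  hence "degree f = Suc (degree g)" unfolding g by (subst degree_mult_eq) auto
  moreover have "s [:-b, 1:] \<le> t [:-b, 1:]" if "poly g b = 0" for b
    using that g f_nonzero Suc.prems by auto
  ultimately have "s g \<le> t g" using Suc.hyps by simp
  thus ?case unfolding g seminorm_mult[OF s] seminorm_mult[OF t]
    using Suc.prems[OF f_nonzero a]
    by (intro mult_mono) (auto simp: seminorm_nonneg[OF s] seminorm_nonneg[OF t])
qed

lemma seminorm_le_iff_linear:
  assumes s: "berk_seminorm v s" and t: "berk_seminorm v t"
  shows "(\<forall>f. s f \<le> t f) \<longleftrightarrow> (\<forall>x. s (linear_form x) \<le> t (linear_form x))"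
proof (intro iffI allI)
  fix f assume linear_le: "\<forall>x. s (linear_form x) \<le> t (linear_form x)"
  have "s [:- a, 1:] \<le> t [:- a, 1:]" for a using linear_le[rule_format, of "(a, 1)"]
    by (simp add: linear_form_def)
  thus "s f \<le> t f" by (rule seminorm_le_of_linear_factors[OF s t])
qed simp

lemma seminorm_eqI:
  assumes s: "berk_seminorm v s" and t: "berk_seminorm v t"
    and eq: "s \<circ> linear_form = t \<circ> linear_form"
  shows "s = t"
proof
  fix f
  have "s (linear_form x) = t (linear_form x)" for x using eq by (metis comp_apply)
  thus "s f = t f" using seminorm_le_iff_linear[OF s t] seminorm_le_iff_linear[OF t s]
    by (simp add: antisym)
qed

subsection \<open>Extending a seminorm from linear forms to polynomials\<close>

definition extension :: "('a \<times> 'a \<Rightarrow> real) \<Rightarrow> 'a poly \<Rightarrow> real" where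
  "extension N f = (INF b. disc b (N (b, 1)) f)"

context
  fixes N
  assumes N: "ultra_seminorm N" and axis: "N (1, 0) = 1"
begin

lemma radius_le: "N (a, 1) \<le> max (v (b - a)) (N (b, 1))"
  using ultra_diff[OF N, of "(b, 1)" "(b - a, 0)"] ultra_axes(1)[OF N, of "b - a"]
  by (simp add: axis max.commute)

lemma distance_le_radius: "v (a - b) \<le> max (N (a, 1)) (N (b, 1))"
  using ultra_diff[OF N, of "(a, 1)" "(b, 1)"] ultra_axes(1)[OF N, of "a - b"] by (simp add: axis)

lemma disc_radius_seminorm: "berk_seminorm v (disc b (N (b, 1)))"
  by (intro disc_seminorm ultra_nonneg[OF N])

lemma disc_minimal:
  assumes b: "f \<noteq> 0 \<Longrightarrow> (\<And>a. poly f a = 0 \<Longrightarrow> N (b, 1) \<le> N (a, 1))"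
  shows "disc b (N (b, 1)) f \<le> disc b' (N (b', 1)) f"
proof (rule seminorm_le_of_linear_factors[OF disc_radius_seminorm disc_radius_seminorm])
  fix a assume "f \<noteq> 0" "poly f a = 0"
  hence "N (b, 1) \<le> N (a, 1)" by (rule b)
  thus "disc b (N (b, 1)) [:- a, 1:] \<le> disc b' (N (b', 1)) [:- a, 1:]"
    unfolding disc_linear using distance_le_radius[of b a] radius_le[of a b'] by auto
qed

text \<open>A centre of minimal radius among the roots of finitely many polynomials computes the
  infimum for all of them, so on finitely many polynomials the extension is a disc seminorm.\<close>

lemma extension_eq_disc:
  assumes "finite F"
  obtains b where "\<And>f. f \<in> F \<Longrightarrow> extension N f = disc b (N (b, 1)) f"
proof -
  define A where "A = insert 0 (\<Union>f\<in>F - {0}. {a. poly f a = 0})"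
  have A: "finite A" "A \<noteq> {}" unfolding A_def using assms poly_roots_finite by auto
  define b where "b = arg_min_on (\<lambda>a. N (a, 1)) A"
  have b: "b \<in> A" "\<forall>a\<in>A. N (b, 1) \<le> N (a, 1)"
    unfolding b_def using arg_min_if_finite(1)[OF A] arg_min_least[OF A] by auto
  have "extension N f = disc b (N (b, 1)) f" if f: "f \<in> F" for f
    unfolding extension_def
  proof (rule cInf_eq_minimum)
    fix q assume "q \<in> range (\<lambda>b. disc b (N (b, 1)) f)"
    moreover have "disc b (N (b, 1)) f \<le> disc b' (N (b', 1)) f" for b'
      using f b by (intro disc_minimal) (auto simp: A_def)
    ultimately show "disc b (N (b, 1)) f \<le> q" by blast
  qed simp
  thus thesis by (rule that)
qed

lemma extension_seminorm: "berk_seminorm v (extension N)"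
  unfolding berk_seminorm_def
proof (intro conjI allI)
  fix f g c
  note s = disc_radius_seminorm
  obtain b where "\<And>h. h \<in> {f, g, f + g, f * g, [:c:]} \<Longrightarrow> extension N h = disc b (N (b, 1)) h"
    using extension_eq_disc[of "{f, g, f + g, f * g, [:c:]}"] by blast
  thus "0 \<le> extension N f" "extension N [:c:] = v c"
    "extension N (f * g) = extension N f * extension N g"
    "extension N (f + g) \<le> extension N f + extension N g"
    using seminorm_nonneg[OF s] seminorm_const[OF s] seminorm_mult[OF s] seminorm_triangle[OF s]
    by simp_all
qed

lemma extension_monic_linear: "extension N [:- a, 1:] = N (a, 1)"
  unfolding extension_def
proof (rule cInf_eq_minimum)
  show "N (a, 1) \<in> range (\<lambda>b. disc b (N (b, 1)) [:- a, 1:])"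
    by (intro image_eqI[of _ _ a]) (simp_all add: disc_linear ultra_nonneg[OF N])
qed (auto simp: disc_linear intro: radius_le)

lemma extension_linear_form: "extension N \<circ> linear_form = N"
proof
  fix x
  note s = extension_seminorm
  show "(extension N \<circ> linear_form) x = N x"
  proof (cases "snd x = 0")
    case True
    hence "N x = v (fst x)" using ultra_axes(1)[OF N, of "fst x"] by (cases x) (simp add: axis)
    thus ?thesis using True by (simp add: linear_form_def seminorm_const[OF s])
  next
    case False
    hence x: "x = snd x \<odot> (fst x / snd x, 1)" by (simp add: prod_eq_iff)
    have "extension N (linear_form x) = v (snd x) * extension N (linear_form (fst x / snd x, 1))"
      by (subst x) (simp only: linear_form_scale seminorm_smult[OF s])
    also have "\<dots> = v (snd x) * N (fst x / snd x, 1)"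
      using extension_monic_linear[of "fst x / snd x"] by (simp add: linear_form_def)
    also have "\<dots> = N x" unfolding ultra_scale[OF N, symmetric] x[symmetric] ..
    finally show ?thesis by simp
  qed
qed

end

end

section \<open>Spherical kernels of Berkovich points\<close>

context nonarch_field
begin

fun kernel :: "'a berk \<Rightarrow> 'a \<times> 'a \<Rightarrow> real" where
  "kernel (BFin s) = normed (s \<circ> linear_form)"
| "kernel BInf = v \<circ> snd"

lemma BFin_mem [simp]: "BFin s \<in> P1Berk v \<longleftrightarrow> berk_seminorm v s"
  and BInf_mem [simp]: "BInf \<in> P1Berk v"
  by (auto simp: P1Berk_def)

lemma unit_kernel:
  assumes "x \<in> P1Berk v"
  shows "unit_seminorm (kernel x)"
proof (cases x)
  case (BFin s)
  thus ?thesis using assms by (simp add: unit_normed ultra_linear_form height_linear_form_pos)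
next
  case BInf
  thus ?thesis by (auto simp: unit_seminorm_def ultra_seminorm_def height_def v_mult v_add)
qed

lemmas ultra_kernel = unit_kernel[THEN unit_ultra]

lemma kernel_axis:
  assumes "berk_seminorm v s"
  shows "kernel (BFin s) (1, 0) = 1 / max 1 (s [:0, 1:])"
  by (simp add: normed_def height_linear_form[OF assms] seminorm_linear_form_axis[OF assms])

lemma diamG_eq_diam_kernel:
  assumes "x \<in> P1Berk v"
  shows "diamG v x = diam (kernel x)"
proof (cases x)
  case (BFin s)
  hence s: "berk_seminorm v s" using assms by simp
  have "covol (s \<circ> linear_form) = (INF a. s [:- a, 1:])"
    using covol_eq_INF[OF ultra_linear_form[OF s]] seminorm_linear_form_axis[OF s]
    by (simp add: linear_form_def)
  thus ?thesis
    using diam_normed[OF ultra_linear_form[OF s] height_linear_form_pos[OF s]]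
    by (simp add: BFin height_linear_form[OF s])
next
  case BInf
  thus ?thesis using diam_unit_le[OF unit_kernel] diam_nonneg[OF ultra_kernel] assms
    by (metis antisym comp_apply diamG.simps(2) kernel.simps(2) snd_conv v_0)
qed

lemma zetaG_eq_gauss: "zetaG v = BFin (gauss 1)"
  by (simp add: zetaG_def gauss_def fun_eq_iff)

lemma zetaG_mem: "zetaG v \<in> P1Berk v"
  by (simp add: zetaG_eq_gauss gauss_seminorm)

lemma kernel_zetaG: "kernel (zetaG v) = max_norm"
proof -
  have "gauss 1 (linear_form x) = max_norm x" for x
    by (auto simp: gauss_def linear_form_def max_norm_def atMost_Suc max.commute)
  hence "gauss 1 \<circ> linear_form = max_norm" by (simp add: fun_eq_iff)
  thus ?thesis by (simp add: zetaG_eq_gauss normed_unit unit_max_norm)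
qed

subsection \<open>Points of type I\<close>

definition proj :: "'a \<times> 'a \<Rightarrow> 'a option" where
  "proj x = (if snd x = 0 then None else Some (fst x / snd x))"

lemma ex_proj: "\<exists>x. x \<noteq> 0 \<and> p = proj x"
proof (cases p)
  case None
  thus ?thesis by (intro exI[of _ "(1, 0)"]) (simp add: proj_def zero_prod_def)
next
  case (Some z)
  thus ?thesis by (intro exI[of _ "(z, 1)"]) (simp add: proj_def zero_prod_def)
qed

lemma proj_scale: "k \<noteq> 0 \<Longrightarrow> proj (k \<odot> x) = proj x"
  by (simp add: proj_def)

lemma max_1_divide: "r \<noteq> 0 \<Longrightarrow> max 1 (v (p / r)) = max_norm (p, r) / v r"
  by (auto simp: max_norm_def v_divide max_def field_simps)

lemma chordal_proj:
  assumes "x \<noteq> 0" "y \<noteq> 0"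
  shows "chordal v (proj x) (proj y) = v (wedge x y) / (max_norm x * max_norm y)"
proof -
  obtain p r p' r' where xy: "x = (p, r)" "y = (p', r')" by fastforce
  show ?thesis
  proof (cases "r = 0 \<or> r' = 0")
    case False
    hence "p / r - p' / r' = wedge x y / (r * r')" by (simp add: xy wedge_def field_simps)
    hence "v (p / r - p' / r') = v (wedge x y) / (v r * v r')" by (simp add: v_divide v_mult)
    thus ?thesis using False by (simp add: xy proj_def max_1_divide)
  qed (use assms in \<open>auto simp: xy proj_def max_1_divide wedge_def zero_prod_def v_mult
      max_norm_def\<close>)
qed

lemma chordal_nonneg: "0 \<le> chordal v p q"
  by (cases p; cases q) auto

lemma chordal_self [simp]: "chordal v p p = 0"
  by (cases p) auto

lemma typeI_mem: "typeI v p \<in> P1Berk v"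
  by (cases p) (simp_all add: seminorm_eval)

lemma kernel_typeI_proj:
  assumes "x \<noteq> 0"
  shows "kernel (typeI v (proj x)) = normed (\<lambda>z. v (wedge x z))"
proof (cases "snd x = 0")
  case True
  hence "fst x \<noteq> 0" using assms by (simp add: prod_eq_iff)
  moreover have "(\<lambda>z. v (wedge x z)) = (\<lambda>z. v (fst x) * kernel BInf z)"
    using True by (simp add: wedge_def v_mult fun_eq_iff)
  ultimately show ?thesis
    using True unit_kernel[of BInf]
    by (simp add: proj_def normed_mult normed_unit del: kernel.simps)
next
  case False
  have "poly (linear_form z) (fst x / snd x) = 1 / snd x * wedge x z" for z
    using False by (simp add: linear_form_def wedge_def field_simps)
  hence "(\<lambda>f. v (poly f (fst x / snd x))) \<circ> linear_form = (\<lambda>z. v (1 / snd x) * v (wedge x z))"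
    by (simp add: fun_eq_iff v_mult[symmetric])
  moreover have "0 < v (1 / snd x)" using False by simp
  ultimately show ?thesis using False by (simp add: proj_def normed_mult)
qed

lemma height_wedge: "height (\<lambda>z. v (wedge x z)) = max_norm x"
  by (simp add: height_def max_norm_def max.commute)

end

section \<open>The Berkovich projective line as a tree of kernels\<close>

context alg_closed_nonarch_field
begin

lemma kernel_inject:
  assumes x: "x \<in> P1Berk v" and y: "y \<in> P1Berk v" and eq: "kernel x = kernel y"
  shows "x = y"
proof -
  have pos: "0 < kernel (BFin s) (1, 0)" if "berk_seminorm v s" for s
    unfolding kernel_axis[OF that] by simp
  have zero: "kernel BInf (1, 0) = 0" by simp
  show ?thesis
  proof (cases x; cases y)
    fix s t assume xy: "x = BFin s" "y = BFin t"
    hence s: "berk_seminorm v s" and t: "berk_seminorm v t" using x y by simp_all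
    have heights_eq: "height (s \<circ> linear_form) = height (t \<circ> linear_form)"
      using fun_cong[OF eq, of "(1, 0)"] kernel_axis[OF s] kernel_axis[OF t]
      by (simp add: xy height_linear_form[OF s] height_linear_form[OF t] del: kernel.simps)
    have "s (linear_form z) = t (linear_form z)" for z
      using fun_cong[OF eq, of z] height_linear_form_pos[OF t]
      by (simp add: xy normed_def heights_eq)
    hence "s = t" by (intro seminorm_eqI s t) (simp add: fun_eq_iff)
    thus ?thesis by (simp add: xy)
  qed (use x y eq pos zero in \<open>metis BFin_mem less_irrefl\<close>)+
qed

lemma kernel_surj:
  assumes N: "unit_seminorm N"
  obtains x where "x \<in> P1Berk v" "kernel x = N"
proof (cases "N (1, 0) = 0")
  case True
  thus thesis using unit_eq_v_snd[OF N] by (intro that[of BInf]) simp_all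
next
  case False
  note ultra = unit_ultra[OF N]
  define t where "t = 1 / N (1, 0)"
  have t: "0 < t" using False ultra_nonneg[OF ultra, of "(1, 0)"] by (simp add: t_def)
  define M where "M = (\<lambda>x. t * N x)"
  have M: "ultra_seminorm M" "M (1, 0) = 1"
    using ultra_mult[OF ultra, of t] t False by (simp_all add: M_def t_def)
  have "kernel (BFin (extension M)) = normed M" by (simp add: extension_linear_form[OF M])
  also have "\<dots> = N" unfolding M_def normed_mult[OF t] by (rule normed_unit[OF N])
  finally show thesis using extension_seminorm[OF M]
    by (intro that[of "BFin (extension M)"]) simp_all
qed

lemma berk_le_iff_kernel:
  assumes x: "x \<in> P1Berk v" and y: "y \<in> P1Berk v"
  shows "berk_le x y \<longleftrightarrow> inf_le (kernel x) (kernel y)"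
proof (cases y)
  case yt: (BFin t)
  hence t: "berk_seminorm v t" using y by simp
  note t_pos = height_linear_form_pos[OF t]
  show ?thesis
  proof (cases x)
    case xs: (BFin s)
    hence s: "berk_seminorm v s" using x by simp
    note s_pos = height_linear_form_pos[OF s]
    have "kernel x z * kernel y (1, 0) \<le> kernel y z * kernel x (1, 0)
        \<longleftrightarrow> s (linear_form z) \<le> t (linear_form z)" for z
      using s_pos t_pos
      by (simp add: xs yt normed_def seminorm_linear_form_axis[OF s] seminorm_linear_form_axis[OF t]
          field_simps)
    thus ?thesis using seminorm_le_iff_linear[OF s t] by (simp add: xs yt inf_le_def)
  next
    case BInf
    have "\<not> kernel x (0, 1) * kernel y (1, 0) \<le> kernel y (0, 1) * kernel x (1, 0)"
      using kernel_axis[OF t] by (simp add: BInf yt not_le less_max_iff_disj del: kernel.simps(1))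
    hence "\<not> inf_le (kernel x) (kernel y)" using inf_leD by blast
    thus ?thesis by (simp add: BInf yt)
  qed
next
  case BInf
  thus ?thesis using ultra_nonneg[OF ultra_kernel[OF x]] by (simp add: inf_le_def)
qed

lemma berk_le_antisym: "berk_le x y \<Longrightarrow> berk_le y x \<Longrightarrow> x = y"
  by (cases x; cases y) (auto simp: fun_eq_iff intro: antisym)

lemma berk_join_eqI:
  assumes "z \<in> P1Berk v" "berk_le x z" "berk_le y z"
    and "\<And>w. w \<in> P1Berk v \<Longrightarrow> berk_le x w \<Longrightarrow> berk_le y w \<Longrightarrow> berk_le z w"
  shows "berk_join v x y = z"
  unfolding berk_join_def using assms by (intro the_equality) (auto intro: berk_le_antisym)

lemma
  assumes x: "x \<in> P1Berk v"
  shows berk_join_zetaG_mem: "berk_join v x (zetaG v) \<in> P1Berk v"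
    and kernel_berk_join_zetaG: "kernel (berk_join v x (zetaG v)) = inf_join (kernel x)"
proof -
  obtain j where j: "j \<in> P1Berk v" "kernel j = inf_join (kernel x)"
    using kernel_surj[OF unit_inf_join[OF unit_kernel[OF x]]] .
  have "berk_join v x (zetaG v) = j"
    using inf_join_upper[OF ultra_kernel[OF x]] inf_join_least[OF ultra_kernel[OF x]]
    by (intro berk_join_eqI) (simp_all add: berk_le_iff_kernel x j zetaG_mem kernel_zetaG)
  thus "berk_join v x (zetaG v) \<in> P1Berk v" "kernel (berk_join v x (zetaG v)) = inf_join (kernel x)"
    using j by simp_all
qed

lemma seg_zetaG:
  assumes x: "x \<in> P1Berk v"
  shows "seg v x (zetaG v) = {z \<in> P1Berk v. \<forall>y. kernel x y \<le> kernel z y}"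
proof -
  have "(berk_le x z \<and> berk_le z (berk_join v x (zetaG v)))
      \<or> (berk_le (zetaG v) z \<and> berk_le z (berk_join v x (zetaG v)))
      \<longleftrightarrow> (\<forall>y. kernel x y \<le> kernel z y)" if z: "z \<in> P1Berk v" for z
    using between_iff_unit_le[OF unit_kernel[OF x] unit_kernel[OF z]]
    by (auto simp: berk_le_iff_kernel x z zetaG_mem berk_join_zetaG_mem kernel_berk_join_zetaG
        kernel_zetaG)
  thus ?thesis unfolding seg_def by blast
qed

lemma
  assumes x: "x \<in> P1Berk v" and y: "y \<in> P1Berk v"
  shows veeG_mem: "veeG v x y \<in> P1Berk v"
    and kernel_veeG: "kernel (veeG v x y) = (\<lambda>z. max (kernel x z) (kernel y z))"
proof -
  obtain j where j: "j \<in> P1Berk v" "kernel j = (\<lambda>z. max (kernel x z) (kernel y z))"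
    using kernel_surj[OF unit_sup[OF unit_kernel[OF x] unit_kernel[OF y]]] .
  have seg_j: "seg v j (zetaG v) = seg v x (zetaG v) \<inter> seg v y (zetaG v)"
    unfolding seg_zetaG[OF x] seg_zetaG[OF y] seg_zetaG[OF j(1)] j(2) by auto
  have "veeG v x y = j" unfolding veeG_def
  proof (rule the_equality)
    fix w assume "w \<in> P1Berk v \<and> seg v w (zetaG v) = seg v x (zetaG v) \<inter> seg v y (zetaG v)"
    hence w: "w \<in> P1Berk v" and "seg v w (zetaG v) = seg v j (zetaG v)" using seg_j by simp_all
    hence "w \<in> seg v j (zetaG v)" "j \<in> seg v w (zetaG v)"
      using seg_zetaG[OF w] seg_zetaG[OF j(1)] j w by auto
    hence "kernel w z \<le> kernel j z" "kernel j z \<le> kernel w z" for z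
      unfolding seg_zetaG[OF w] seg_zetaG[OF j(1)] by blast+
    hence "kernel w = kernel j" by (intro ext antisym)
    thus "w = j" by (rule kernel_inject[OF w j(1)])
  qed (use j seg_j in blast)
  thus "veeG v x y \<in> P1Berk v" "kernel (veeG v x y) = (\<lambda>z. max (kernel x z) (kernel y z))"
    using j by simp_all
qed

lemma berk_d_eq_tree_dist:
  assumes "x \<in> P1Berk v" "y \<in> P1Berk v"
  shows "berk_d v x y = tree_dist (kernel x) (kernel y)"
  using assms by (simp add: berk_d_def tree_dist_def diamG_eq_diam_kernel veeG_mem kernel_veeG)

lemma diam_kernel_typeI: "diam (kernel (typeI v p)) = 0"
proof -
  obtain x where x: "x \<noteq> 0" "p = proj x" using ex_proj by blast
  have ultra: "ultra_seminorm (kernel (typeI v p))" by (intro ultra_kernel typeI_mem)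
  have "diam (kernel (typeI v p)) * max_norm x \<le> kernel (typeI v p) x"
    by (rule diam_mult_le[OF ultra])
  also have "\<dots> = 0" using x by (simp add: kernel_typeI_proj normed_def)
  finally have "diam (kernel (typeI v p)) \<le> 0" using x(1)
    by (metis max_norm_pos_iff mult_pos_pos not_le)
  thus ?thesis using diam_nonneg[OF ultra] by simp
qed

lemma berk_d_typeI: "berk_d v (typeI v p) (typeI v q) = 2 * chordal v p q"
proof -
  obtain x where x: "x \<noteq> 0" "p = proj x" using ex_proj by blast
  obtain y where y: "y \<noteq> 0" "q = proj y" using ex_proj by blast
  define X Y where "X = max_norm x" and "Y = max_norm y"
  have XY: "0 < X" "0 < Y" using x y by (simp_all add: X_def Y_def)
  define J where "J = (\<lambda>z. max (kernel (typeI v p) z) (kernel (typeI v q) z))"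
  have ultra: "ultra_seminorm J" unfolding J_def by (intro ultra_sup ultra_kernel typeI_mem)
  have J: "J z = max (v (wedge x z) / X) (v (wedge y z) / Y)" for z
    using x y by (simp add: J_def kernel_typeI_proj normed_def height_wedge X_def Y_def)
  have "diam J = v (wedge x y) / (X * Y)"
  proof (rule antisym)
    have "diam J * X \<le> J x" unfolding X_def by (rule diam_mult_le[OF ultra])
    also have "J x = v (wedge x y) / Y" using XY by (simp add: J wedge_commute[of x y])
    finally show "diam J \<le> v (wedge x y) / (X * Y)" using XY by (simp add: field_simps)
    show "v (wedge x y) / (X * Y) \<le> diam J"
    proof (rule diam_ge)
      fix z assume "max_norm z = 1"
      hence "v (wedge x y) \<le> max (v (wedge y z) * X) (v (wedge x z) * Y)"
        using ptolemy[OF ultra_max_norm, of x y z] by (simp add: X_def Y_def wedge_commute[of y z])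
      also have "\<dots> = J z * (X * Y)" using XY by (simp add: J max_mult_distrib_right max.commute)
      finally show "v (wedge x y) / (X * Y) \<le> J z" using XY by (simp add: pos_divide_le_eq)
    qed
  qed
  thus ?thesis using x y
    by (simp add: berk_d_eq_tree_dist typeI_mem tree_dist_def diam_kernel_typeI chordal_proj
        J_def X_def Y_def)
qed

end

section \<open>The Moebius action on the Berkovich line\<close>

lemma (in alg_closed_nonarch_field) maximal_unit_vectors:
  assumes N: "ultra_seminorm N" and pos: "0 < height N"
  obtains x y where "max_norm x = 1" "max_norm y = 1" "N x = height N" "N y = height N"
    "wedge x y \<noteq> 0"
proof -
  obtain t where t: "t \<noteq> 0" "v t < 1" using ex_v_less_1 by blast
  have small: "N (t \<odot> z) < height N" if "N z \<le> height N" for z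
  proof -
    have "v t * N z \<le> v t * height N" using that by (intro mult_left_mono) simp_all
    also have "\<dots> < height N" using t pos by simp
    finally show ?thesis by (simp only: ultra_scale[OF N])
  qed
  consider (first) "N (1, 0) = height N" | (second) "N (0, 1) = height N"
    by (metis height_def max_def)
  thus thesis
  proof cases
    case first
    moreover have "N ((1, 0) + t \<odot> (0, 1)) = N (1, 0)"
      unfolding first using first small[of "(0, 1)"]
      by (subst ultra_add_eq_max[OF N]) (simp_all add: height_def)
    ultimately show thesis using t
      by (intro that[of "(1, 0)" "(1, t)"]) (simp_all add: max_norm_def)
  next
    case second
    moreover have "N ((0, 1) + t \<odot> (1, 0)) = N (0, 1)"
      unfolding second using second small[of "(1, 0)"]
      by (subst ultra_add_eq_max[OF N]) (simp_all add: height_def)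
    ultimately show thesis using t
      by (intro that[of "(0, 1)" "(t, 1)"]) (simp_all add: max_norm_def)
  qed
qed

lemma poly_mob_num:
  fixes a b c e :: "'a::field"
  assumes "c * x + e \<noteq> 0"
  shows "poly (mob_num a b c e f) x = (c * x + e) ^ degree f * poly f ((a * x + b) / (c * x + e))"
proof -
  have "(c * x + e) ^ degree f * poly f ((a * x + b) / (c * x + e))
      = (\<Sum>i\<le>degree f. coeff f i * ((a * x + b) ^ i * (c * x + e) ^ (degree f - i)))"
    unfolding poly_altdef sum_distrib_left
  proof (rule sum.cong)
    fix i assume "i \<in> {..degree f}"
    hence "(c * x + e) ^ degree f = (c * x + e) ^ i * (c * x + e) ^ (degree f - i)"
      by (simp flip: power_add)
    thus "(c * x + e) ^ degree f * (coeff f i * ((a * x + b) / (c * x + e)) ^ i)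
        = coeff f i * ((a * x + b) ^ i * (c * x + e) ^ (degree f - i))"
      using assms by (simp add: power_divide)
  qed simp
  thus ?thesis by (simp add: mob_num_def poly_sum mult.commute[of x] add.commute)
qed

context moebius
begin

lemma mat_neq_0: "x \<noteq> 0 \<Longrightarrow> mat x \<noteq> 0"
  and adj_neq_0: "x \<noteq> 0 \<Longrightarrow> adj x \<noteq> 0"
  using adj_mat[of x] mat_adj[of x] det by (auto simp: prod_eq_iff mat_def adj_def)

lemma mob_proj:
  assumes "x \<noteq> 0"
  shows "mob a b c e (proj x) = proj (mat x)"
proof (cases "snd x = 0")
  case True
  hence "fst x \<noteq> 0" using assms by (simp add: prod_eq_iff)
  thus ?thesis using True by (simp add: proj_def mat_def)
next
  case False
  hence "c * (fst x / snd x) + e = snd (mat x) / snd x"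
    "a * (fst x / snd x) + b = fst (mat x) / snd x"
    by (simp_all add: mat_def field_simps)
  thus ?thesis using False by (simp add: proj_def)
qed

lemma denominator_neq_0: "[:e, c:] \<noteq> 0"
  using det by auto

end

locale berk_moebius = moebius v a b c e + alg_closed_nonarch_field v
  for v :: "'a::field \<Rightarrow> real" and a b c e :: 'a
begin

lemma poly_eqI_off_pole:
  assumes "\<And>x. c * x + e \<noteq> 0 \<Longrightarrow> poly p x = poly q x"
  shows "p = q"
proof (rule poly_eqI_cofinite[OF infinite_field])
  have "{x. poly p x \<noteq> poly q x} \<subseteq> {x. poly [:e, c:] x = 0}"
    using assms by (auto simp: mult.commute add.commute)
  thus "finite {x. poly p x \<noteq> poly q x}"
    using poly_roots_finite[OF denominator_neq_0] by (rule finite_subset)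
qed

lemma mob_num_mult:
  assumes "f \<noteq> 0" "g \<noteq> 0"
  shows "mob_num a b c e (f * g) = mob_num a b c e f * mob_num a b c e g"
  by (rule poly_eqI_off_pole) (simp add: poly_mob_num degree_mult_eq[OF assms] power_add)

lemma mob_num_add:
  assumes "degree f \<le> n" "degree g \<le> n"
  shows "mob_num a b c e (f + g) * [:e, c:] ^ (n - degree (f + g))
    = mob_num a b c e f * [:e, c:] ^ (n - degree f) + mob_num a b c e g * [:e, c:] ^ (n - degree g)"
proof (rule poly_eqI_off_pole)
  fix x assume x: "c * x + e \<noteq> 0"
  have homogenized: "poly (mob_num a b c e h * [:e, c:] ^ (n - degree h)) x
      = (c * x + e) ^ n * poly h ((a * x + b) / (c * x + e))" if "degree h \<le> n" for h
  proof -
    have "(c * x + e) ^ n = (c * x + e) ^ degree h * (c * x + e) ^ (n - degree h)"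
      using that by (simp flip: power_add)
    thus ?thesis by (simp add: poly_mob_num[OF x] mult.commute[of x] add.commute mult_ac)
  qed
  have "degree (f + g) \<le> n" using assms by (rule degree_add_le)
  thus "poly (mob_num a b c e (f + g) * [:e, c:] ^ (n - degree (f + g))) x
    = poly (mob_num a b c e f * [:e, c:] ^ (n - degree f)
        + mob_num a b c e g * [:e, c:] ^ (n - degree g)) x"
    using assms unfolding poly_add by (simp only: homogenized poly_add distrib_left)
qed

definition pushforward :: "('a poly \<Rightarrow> real) \<Rightarrow> 'a poly \<Rightarrow> real" where
  "pushforward s f = s (mob_num a b c e f) / s [:e, c:] ^ degree f"

context
  fixes s
  assumes s: "berk_seminorm v s" and pole: "s [:e, c:] \<noteq> 0"
begin

lemma seminorm_denominator_pos: "0 < s [:e, c:]"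
  using pole seminorm_nonneg[OF s, of "[:e, c:]"] by simp

lemma pushforward_homogenized:
  assumes "degree f \<le> n"
  shows "pushforward s f = s (mob_num a b c e f * [:e, c:] ^ (n - degree f)) / s [:e, c:] ^ n"
proof -
  have "s [:e, c:] ^ n = s [:e, c:] ^ degree f * s [:e, c:] ^ (n - degree f)"
    using assms by (simp flip: power_add)
  thus ?thesis using pole by (simp add: pushforward_def seminorm_mult[OF s] seminorm_power[OF s])
qed

lemma pushforward_seminorm: "berk_seminorm v (pushforward s)"
  unfolding berk_seminorm_def
proof (intro conjI allI)
  fix f g k
  show "0 \<le> pushforward s f" by (simp add: pushforward_def seminorm_nonneg[OF s])
  show "pushforward s [:k:] = v k" by (simp add: pushforward_def mob_num_def seminorm_const[OF s])
  show "pushforward s (f * g) = pushforward s f * pushforward s g"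
  proof (cases "f = 0 \<or> g = 0")
    case True
    thus ?thesis by (auto simp: pushforward_def mob_num_def seminorm_0[OF s])
  next
    case False
    thus ?thesis
      by (simp add: pushforward_def mob_num_mult seminorm_mult[OF s] degree_mult_eq power_add)
  qed
  define n where "n = max (degree f) (degree g)"
  have n: "degree f \<le> n" "degree g \<le> n" by (simp_all add: n_def)
  show "pushforward s (f + g) \<le> pushforward s f + pushforward s g"
    unfolding pushforward_homogenized[OF n(1)] pushforward_homogenized[OF n(2)]
      pushforward_homogenized[OF degree_add_le[OF n]] mob_num_add[OF n]
      add_divide_distrib[symmetric]
    using seminorm_denominator_pos by (intro divide_right_mono seminorm_triangle[OF s]) simp
qed

lemma pushforward_linear_form:
  "pushforward s (linear_form x) = s (linear_form (adj x)) / s [:e, c:]"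
proof (cases "snd x = 0")
  case True
  have "s (linear_form (adj x)) = v (fst x) * s [:e, c:]"
    using True seminorm_smult[OF s, of "- fst x" "[:e, c:]"]
    by (simp add: linear_form_def adj_def mult.commute)
  thus ?thesis using True pole
    by (simp add: pushforward_def linear_form_def[of x] mob_num_def seminorm_const[OF s])
next
  case False
  thus ?thesis by (simp add: pushforward_def linear_form_def mob_num_def adj_def algebra_simps)
qed

lemma kernel_pushforward: "kernel (BFin (pushforward s)) = normed (s \<circ> linear_form \<circ> adj)"
proof -
  have "pushforward s \<circ> linear_form = (\<lambda>x. (1 / s [:e, c:]) * (s \<circ> linear_form \<circ> adj) x)"
    by (simp add: fun_eq_iff pushforward_linear_form)
  thus ?thesis using seminorm_denominator_pos
    by (simp only: kernel.simps normed_mult zero_less_divide_1_iff)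
qed

end

lemma mob_berk_BFin:
  "mob_berk v a b c e (BFin s) = (if s [:e, c:] = 0 then BInf else BFin (pushforward s))"
  by (simp add: pushforward_def[abs_def])

lemma mob_berk_BInf: "mob_berk v a b c e BInf = typeI v (mob a b c e None)"
  by simp

lemma mob_berk_mem:
  assumes "x \<in> P1Berk v"
  shows "mob_berk v a b c e x \<in> P1Berk v"
proof (cases x)
  case (BFin s)
  thus ?thesis using assms by (simp add: mob_berk_BFin pushforward_seminorm del: mob_berk.simps)
qed (simp add: mob_berk_BInf typeI_mem del: mob_berk.simps)

lemma act_normed_wedge:
  assumes "x \<noteq> 0"
  shows "act (normed (\<lambda>z. v (wedge x z))) = normed (\<lambda>z. v (wedge (mat x) z))"
  using assms unfolding act_def
  by (subst normed_normed_comp) (simp_all add: height_wedge comp_def wedge_mat_left)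

lemma kernel_typeI_mob: "kernel (typeI v (mob a b c e p)) = act (kernel (typeI v p))"
proof -
  obtain x where x: "x \<noteq> 0" "p = proj x" using ex_proj by blast
  thus ?thesis by (simp add: mob_proj kernel_typeI_proj mat_neq_0 act_normed_wedge)
qed

lemma kernel_mob_berk:
  assumes x: "x \<in> P1Berk v"
  shows "kernel (mob_berk v a b c e x) = act (kernel x)"
proof (cases x)
  case (BFin s)
  hence s: "berk_seminorm v s" using x by simp
  have act: "act (kernel x) = normed (s \<circ> linear_form \<circ> adj)"
    using normed_normed_comp[OF height_linear_form_pos[OF s]] by (simp add: BFin act_def)
  show ?thesis
  proof (cases "s [:e, c:] = 0")
    case True
    have "s (linear_form (adj (1, 0))) = 0"
      using True seminorm_smult[OF s, of "- 1" "[:e, c:]"] by (simp add: linear_form_def adj_def)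
    hence "act (kernel x) (1, 0) = 0" by (simp add: act normed_def)
    hence "act (kernel x) = kernel BInf"
      using unit_eq_v_snd[OF unit_act[OF unit_kernel[OF x]]] by simp
    thus ?thesis using True by (simp add: BFin mob_berk_BFin del: mob_berk.simps)
  next
    case False
    thus ?thesis unfolding act
      by (simp only: BFin mob_berk_BFin if_False kernel_pushforward[OF s False])
  qed
next
  case BInf
  thus ?thesis using kernel_typeI_mob[of None] by (simp only: mob_berk_BInf typeI.simps)
qed

lemma mob_berk_typeI: "mob_berk v a b c e (typeI v p) = typeI v (mob a b c e p)"
  by (rule kernel_inject) (simp_all add: mob_berk_mem typeI_mem kernel_mob_berk kernel_typeI_mob)

lemma berk_moebius_inverse: "berk_moebius v e (- b) (- c) a"
  by (intro berk_moebius.intro moebius_inverse alg_closed_nonarch_field_axioms)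

lemma mob_berk_inverse:
  assumes x: "x \<in> P1Berk v"
  shows "mob_berk v e (- b) (- c) a (mob_berk v a b c e x) = x"
proof -
  interpret inv: berk_moebius v e "- b" "- c" a by (rule berk_moebius_inverse)
  show ?thesis
    by (rule kernel_inject)
      (simp_all add: inv.mob_berk_mem mob_berk_mem inv.kernel_mob_berk kernel_mob_berk x
          act_inverse unit_kernel)
qed

subsection \<open>Lipschitz constants\<close>

lemma berk_d_mob_le:
  assumes x: "x \<in> P1Berk v" and y: "y \<in> P1Berk v"
  shows "berk_d v (mob_berk v a b c e x) (mob_berk v a b c e y) \<le> vmax\<^sup>2 / vdet * berk_d v x y"
  using act_lipschitz[OF unit_kernel[OF x] unit_kernel[OF y]]
  by (simp add: berk_d_eq_tree_dist mob_berk_mem kernel_mob_berk x y)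

lemma chordal_mob_le: "chordal v (mob a b c e p) (mob a b c e q) \<le> vmax\<^sup>2 / vdet * chordal v p q"
  using berk_d_mob_le[OF typeI_mem typeI_mem, of p q]
  unfolding mob_berk_typeI berk_d_typeI mult.left_commute[of "vmax\<^sup>2 / vdet" 2] by simp

text \<open>The inverse map contracts most between two points at which the adjugate attains its norm.\<close>

lemma chordal_mob_attained:
  obtains p q where "0 < chordal v p q"
    "chordal v (mob a b c e p) (mob a b c e q) = vmax\<^sup>2 / vdet * chordal v p q"
proof -
  have height: "height (max_norm \<circ> adj) = vmax" using factor_max_norm by (simp add: factor_def)
  obtain x y where unit: "max_norm x = 1" "max_norm y = 1"
      and adj: "max_norm (adj x) = vmax" "max_norm (adj y) = vmax" and xy: "wedge x y \<noteq> 0"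
    using maximal_unit_vectors[OF ultra_comp_adj[OF ultra_max_norm], unfolded height comp_apply]
      vmax_pos by blast
  have nz: "x \<noteq> 0" "y \<noteq> 0" using unit max_norm_pos_iff[of x] max_norm_pos_iff[of y] by simp_all
  have "chordal v (proj (adj x)) (proj (adj y)) = vdet * v (wedge x y) / vmax\<^sup>2"
    using nz adj by (simp add: chordal_proj adj_neq_0 wedge_adj v_mult vdet_def power2_eq_square)
  moreover have "chordal v (mob a b c e (proj (adj x))) (mob a b c e (proj (adj y)))
      = v (wedge x y)"
    using nz unit det by (simp add: mob_proj adj_neq_0 mat_adj proj_scale chordal_proj)
  ultimately show thesis
    using xy vdet_pos vmax_pos by (intro that[of "proj (adj x)" "proj (adj y)"]) simp_all
qed

lemma quotient_le_lipschitz: "0 \<le> d \<Longrightarrow> d' \<le> vmax\<^sup>2 / vdet * d \<Longrightarrow> d' / d \<le> vmax\<^sup>2 / vdet"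
  using vdet_pos by (cases "d = 0") (auto simp: pos_divide_le_eq)

lemma Lip_P1_eq: "Lip_P1 v a b c e = vmax\<^sup>2 / vdet"
  unfolding Lip_P1_def
proof (rule cSup_eq_maximum)
  obtain p q where pq: "0 < chordal v p q"
      "chordal v (mob a b c e p) (mob a b c e q) = vmax\<^sup>2 / vdet * chordal v p q"
    by (rule chordal_mob_attained)
  hence "p \<noteq> q" "vmax\<^sup>2 / vdet = chordal v (mob a b c e p) (mob a b c e q) / chordal v p q" by auto
  thus "vmax\<^sup>2 / vdet \<in> {chordal v (mob a b c e p) (mob a b c e q) / chordal v p q | p q. p \<noteq> q}"
    by blast
qed (auto intro!: quotient_le_lipschitz chordal_nonneg chordal_mob_le)

lemma Lip_Berk_eq: "Lip_Berk v a b c e = vmax\<^sup>2 / vdet"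
  unfolding Lip_Berk_def
proof (rule cSup_eq_maximum)
  let ?\<phi> = "mob_berk v a b c e"
  obtain p q where pq: "0 < chordal v p q"
      "chordal v (mob a b c e p) (mob a b c e q) = vmax\<^sup>2 / vdet * chordal v p q"
    by (rule chordal_mob_attained)
  have "typeI v p \<noteq> typeI v q"
    using pq(1) berk_d_typeI[of p p] berk_d_typeI[of p q] by auto
  moreover have "vmax\<^sup>2 / vdet
      = berk_d v (?\<phi> (typeI v p)) (?\<phi> (typeI v q)) / berk_d v (typeI v p) (typeI v q)"
    unfolding mob_berk_typeI berk_d_typeI using pq by simp
  ultimately show "vmax\<^sup>2 / vdet \<in> {berk_d v (?\<phi> x) (?\<phi> y) / berk_d v x y | x y.
      x \<in> P1Berk v \<and> y \<in> P1Berk v \<and> x \<noteq> y}"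
    using typeI_mem by blast
next
  have "0 \<le> berk_d v x y" if "x \<in> P1Berk v" "y \<in> P1Berk v" for x y
    using that by (simp add: berk_d_eq_tree_dist tree_dist_nonneg ultra_kernel)
  thus "q \<le> vmax\<^sup>2 / vdet"
    if "q \<in> {berk_d v (mob_berk v a b c e x) (mob_berk v a b c e y) / berk_d v x y | x y.
      x \<in> P1Berk v \<and> y \<in> P1Berk v \<and> x \<noteq> y}" for q
    using that by (auto intro: quotient_le_lipschitz berk_d_mob_le)
qed

subsection \<open>Gauss image radius, Gauss preimage radius and open balls\<close>

lemma GIR_eq: "GIR v a b c e = vdet / vmax\<^sup>2"
  by (simp add: GIR_def diamG_eq_diam_kernel mob_berk_mem zetaG_mem kernel_mob_berk kernel_zetaG
      diam_act unit_max_norm diam_max_norm factor_max_norm)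

lemma GPR_eq: "GPR v a b c e = vdet / vmax\<^sup>2"
proof -
  interpret inv: berk_moebius v e "- b" "- c" a by (rule berk_moebius_inverse)
  let ?\<psi> = "mob_berk v e (- b) (- c) a"
  have \<psi>: "mob_berk v a b c e (?\<psi> (zetaG v)) = zetaG v"
    using inv.mob_berk_inverse[OF zetaG_mem] by simp
  have "x \<in> P1Berk v \<and> mob_berk v a b c e x = zetaG v \<longleftrightarrow> x = ?\<psi> (zetaG v)" for x
    using \<psi> mob_berk_inverse[of x] inv.mob_berk_mem[OF zetaG_mem] by auto
  hence "GPR v a b c e = GIR v e (- b) (- c) a" by (simp add: GPR_def GIR_def)
  also have "\<dots> = inv.vdet / inv.vmax\<^sup>2" by (rule inv.GIR_eq)
  also have "inv.vdet = vdet" by (simp add: vdet_def inv.vdet_def mult.commute)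
  also have "inv.vmax = vmax" by (simp add: vmax_def inv.vmax_def max.commute max.left_commute)
  finally show ?thesis .
qed

lemma zetaG_notin_Bminus: "zetaG v \<notin> Bminus v p r"
proof -
  have "zetaG v \<notin> Bminus_lt v p r" for r
  proof
    assume z: "zetaG v \<in> Bminus_lt v p r"
    define Q where "Q = Qpt v p r"
    have "Q \<in> seg v (zetaG v) (zetaG v)" "Q \<noteq> zetaG v"
      using z by (auto simp: Bminus_lt_def Q_def)
    hence Q: "Q \<in> P1Berk v" "\<And>x. max_norm x \<le> kernel Q x"
      unfolding seg_zetaG[OF zetaG_mem] kernel_zetaG by blast+
    have "kernel Q = kernel (zetaG v)"
      unfolding kernel_zetaG using Q(2) unit_le[OF unit_kernel[OF Q(1)]] by (intro ext antisym)
    thus False using kernel_inject[OF Q(1) zetaG_mem] \<open>Q \<noteq> zetaG v\<close> by simp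
  qed
  thus ?thesis by (auto simp: Bminus_def)
qed

lemma mob_berk_image_neq_P1Berk:
  assumes "B \<subseteq> P1Berk v" "x \<in> P1Berk v" "x \<notin> B"
  shows "mob_berk v a b c e ` B \<noteq> P1Berk v"
proof
  assume "mob_berk v a b c e ` B = P1Berk v"
  then obtain y where y: "y \<in> B" "mob_berk v a b c e x = mob_berk v a b c e y"
    using mob_berk_mem[OF assms(2)] by blast
  hence "x = y" using mob_berk_inverse[of x] mob_berk_inverse[of y] assms by (metis subsetD)
  thus False using y assms by simp
qed

lemma B0_eq: "B0 v a b c e = 1"
  unfolding B0_def
proof (rule cSup_eq_maximum)
  have "Bminus v p 1 \<subseteq> P1Berk v" for p by (auto simp: Bminus_def Bminus_lt_def)
  thus "1 \<in> {r. 0 < r \<and> r \<le> 1 \<and> (\<forall>p. mob_berk v a b c e ` Bminus v p r \<noteq> P1Berk v)}"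
    using mob_berk_image_neq_P1Berk[OF _ zetaG_mem zetaG_notin_Bminus] by simp
qed auto

subsection \<open>The resultant of a normalized representation\<close>

lemma ex_normalized_rep: "\<exists>r. normalized_rep v a b c e r"
proof -
  obtain k where k: "v k = vmax" "k = a \<or> k = b \<or> k = c \<or> k = e"
  proof -
    have "vmax = v a \<or> vmax = v b \<or> vmax = v c \<or> vmax = v e" by (simp add: vmax_def max_def)
    thus thesis using that by metis
  qed
  hence k_nonzero: "k \<noteq> 0" using vmax_pos by auto
  have "mob (a / k) (b / k) (c / k) (e / k) p = mob a b c e p" for p
  proof (cases p)
    case (Some z)
    have "c / k * z + e / k = (c * z + e) / k" "a / k * z + b / k = (a * z + b) / k"
      by (simp_all add: add_divide_distrib)
    thus ?thesis using k_nonzero Some by simp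
  qed (use k_nonzero in simp)
  moreover have "a / k * (e / k) - b / k * (c / k) \<noteq> 0"
    using det k_nonzero by (simp flip: diff_divide_distrib)
  moreover have "v (x / k) \<le> 1" if "v x \<le> vmax" for x using that k vmax_pos by (simp add: v_divide)
  moreover have "v (k / k) = 1" using k_nonzero by simp
  ultimately have "normalized_rep v a b c e (a / k, b / k, c / k, e / k)"
    using k(2) entries_le_vmax unfolding normalized_rep_def sylv_res_lin_def
    by (auto simp: fun_eq_iff)
  thus ?thesis by blast
qed

end

text \<open>The Lipschitz constant on \<open>P\<^sup>1(K)\<close> depends only on the map, so comparing its formula for the
  two representations determines the resultant of a normalized one.\<close>

lemma (in berk_moebius) abs_Res_eq: "abs_Res v a b c e = vdet / vmax\<^sup>2"
proof -
  obtain a' b' c' e' where r: "(SOME r. normalized_rep v a b c e r) = (a', b', c', e')"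
    by (metis prod.exhaust)
  hence normalized: "normalized_rep v a b c e (a', b', c', e')"
    using someI_ex[OF ex_normalized_rep] by simp
  interpret rep: berk_moebius v a' b' c' e'
    by unfold_locales (use normalized in \<open>auto simp: normalized_rep_def sylv_res_lin_def\<close>)
  have "mob a' b' c' e' = mob a b c e" using normalized by (simp add: normalized_rep_def)
  hence "rep.vmax\<^sup>2 / rep.vdet = vmax\<^sup>2 / vdet"
    unfolding Lip_P1_eq[symmetric] rep.Lip_P1_eq[symmetric] by (simp add: Lip_P1_def)
  moreover have "rep.vmax = 1" using normalized unfolding rep.vmax_def normalized_rep_def by auto
  ultimately have "rep.vdet = vdet / vmax\<^sup>2"
    using vdet_pos vmax_pos rep.vdet_pos by (simp add: field_simps)
  thus ?thesis by (simp add: abs_Res_def r sylv_res_lin_def rep.vdet_def)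
qed

theorem theorem3p1:
  fixes v :: "'a::field \<Rightarrow> real" and a b c e :: 'a
  assumes "valued_field_K v"
    and "a * e - b * c \<noteq> 0"
  shows "B0 v a b c e = 1
    \<and> Lip_Berk v a b c e = Lip_P1 v a b c e
    \<and> Lip_P1 v a b c e = 1 / GIR v a b c e
    \<and> 1 / GIR v a b c e = 1 / GPR v a b c e
    \<and> 1 / GPR v a b c e = 1 / abs_Res v a b c e
    \<and> 1 / abs_Res v a b c e = (max (max (v a) (v b)) (max (v c) (v e)))\<^sup>2 / v (a * e - b * c)"
proof -
  interpret berk_moebius v a b c e
    using assms by unfold_locales (simp_all add: valued_field_K_def)
  show ?thesis
    unfolding B0_eq Lip_Berk_eq Lip_P1_eq GIR_eq GPR_eq abs_Res_eq by (simp add: vmax_def vdet_def)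
qed

end
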